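(* Let $(B,\bm{A}^\top)^\top$ be a random vector with $B\in\{-1,1\}$ and $\bm{A}\in\{-1,1\}^p$, and let $(B_i,\bm{A}_i)$, $i=1,\dots,n$, be i.i.d. copies of $(B,\bm{A})$. Assume that $|\mathbf{E}[B\mid\bm{A}]|<1$ and that the vector $\bm{\beta}\in\mathbb{R}^{2^p}$ with $\mathbf{E}[B\mid\bm{A}]=\bm{\beta}^\top\bm{A}^{\otimes}$ is uniquely defined. Let $\hat{\bm{\beta}}=(\mathcal{A}^\top\mathcal{A})^{-1}\mathcal{A}^\top\mathcal{B}$ be the least squares estimator, which exists when $\mathcal{A}^\top\mathcal{A}$ is invertible. Then, whenever $\hat{\bm{\beta}}$ exists, it is also the unique maximum likelihood estimator of $\bm{\beta}$, where the likelihood is with respect to the joint distribution of the $(p+1)\times 1$ binary vector $(B,\bm{A}^\top)^\top$. Moreover, as $n\to\infty$, $\hat{\bm{\beta}}\to\bm{\beta}$ almost surely and $$\sqrt{n}(\hat{\bm{\beta}}-\bm{\beta})\xrightarrow{d}N\left(0,\ \frac{1}{2^{2p}}\mathbf{H}_{2^p}\mathbf{D}\mathbf{H}_{2^p}\right),\qquad \mathbf{D}=\mathrm{diag}\left(\frac{1-(\bm{\beta}^\top\bm{v}_i)^2}{\mathbf{P}(\bm{A}^{\otimes}=\bm{v}_i)}\right)_{i=1}^{2^p},$$ where $\bm{v}_i$ is the $i$th row of $\mathbf{H}_{2^p}$, $1\le i\le 2^p$. In particular, the asymptotic variance of each entry of $\hat{\bm{\beta}}$ (each diagonal entry of the limiting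 covariance matrix) is the same, namely $\mathrm{tr}(\mathbf{D})/2^{2p}$.
   Context: For $\bm{A}\in\{-1,1\}^p$, $\bm{A}^{\otimes}=\begin{pmatrix}1\\ A_1\end{pmatrix}\otimes\cdots\otimes\begin{pmatrix}1\\ A_p\end{pmatrix}\in\{-1,1\}^{2^p}$. $\mathbf{H}_{2^p}$ is the Sylvester Hadamard matrix ($\mathbf{H}_1=(1)$, $\mathbf{H}_{2m}=\begin{pmatrix}\mathbf{H}_m&\mathbf{H}_m\\ \mathbf{H}_m&-\mathbf{H}_m\end{pmatrix}$), whose rows are the $2^p$ possible values of $\bm{A}^{\otimes}$. $\mathcal{B}=(B_1,\dots,B_n)^\top$ and $\mathcal{A}$ is the $n\times 2^p$ matrix with rows $\bm{A}_1^{\otimes\top},\dots,\bm{A}_n^{\otimes\top}$. The vector $\bm{\beta}$ is uniquely defined exactly when $\mathbf{E}[\bm{A}^{\otimes}\bm{A}^{\otimes\top}]$ is positive definite, equivalently when $\mathbf{P}(\bm{A}^{\otimes}=\bm{v})>0$ for all rows $\bm{v}$ of $\mathbf{H}_{2^p}$. The joint distribution of $(B,\bm{A})$ is parametrized by the vector of probabilities $\mathbf{P}(\bm{A}^{\otimes}=\bm{v})$ and by $\bm{\beta}$ ranging over $\{\bm{b}\in\mathbb{R}^{2^p}:\|\mathbf{H}_{2^p}\bm{b}\|_\infty\le1\}$, via $\mathbf{P}(B=r\mid\bm{A}^{\otimes}=\bm{v})=(1+r\bm{\beta}^\top\bm{v})/2$, $r=\pm1$. In the limit statements, $\hat{\bm{\beta}}$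 is given an arbitrary value when $\mathcal{A}^\top\mathcal{A}$ is singular. *)

theory Defs
  imports "HOL-Probability.Probability" "Jordan_Normal_Form.Gauss_Jordan_Elimination"
begin

text \<open>Vectors and matrices are those of Jordan Normal Form, whose dimensions are natural numbers,
  so that the sample size \<open>n\<close> and the dimension \<open>2 ^ p\<close> can both occur as terms. The homonymous
  notions of HOL-Analysis are hidden.\<close>

unbundle no vec_syntax
unbundle no inner_syntax
hide_type (open) Finite_Cartesian_Product.vec
hide_const (open) Finite_Cartesian_Product.vec Finite_Cartesian_Product.row
  Finite_Cartesian_Product.rows Finite_Cartesian_Product.mat Determinants.trace


subsection \<open>Kronecker products and Sylvester Hadamard matrices\<close>

definition sign_vecs :: "nat \<Rightarrow> real vec set" where
  "sign_vecs p = {a \<in> carrier_vec p. \<forall>i<p. a $ i \<in> {-1, 1}}"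

definition kron_vec :: "real vec \<Rightarrow> real vec \<Rightarrow> real vec" where
  "kron_vec u v = vec (dim_vec u * dim_vec v)
     (\<lambda>k. u $ (k div dim_vec v) * v $ (k mod dim_vec v))"

definition tensor_vec :: "real vec \<Rightarrow> real vec" where
  "tensor_vec a = foldr (\<lambda>x v. kron_vec (vec_of_list [1, x]) v) (list_of_vec a) (vec_of_list [1])"

fun sylvester :: "nat \<Rightarrow> real mat" where
  "sylvester 0 = 1\<^sub>m 1"
| "sylvester (Suc k) =
     four_block_mat (sylvester k) (sylvester k) (sylvester k) (- sylvester k)"

definition mat_trace :: "real mat \<Rightarrow> real" where
  "mat_trace S = sum_list (diag_mat S)"

definition linf_norm :: "real vec \<Rightarrow> real" where
  "linf_norm v = Max ((\<lambda>i. \<bar>v $ i\<bar>) ` {..<dim_vec v})"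


subsection \<open>Least squares\<close>

text \<open>A sample of size \<open>n\<close> is given by the first \<open>n\<close> terms of the sequences \<open>r\<close> (responses)
  and \<open>a\<close> (sign vectors), numbered from \<open>0\<close>.\<close>

definition design_matrix :: "nat \<Rightarrow> nat \<Rightarrow> (nat \<Rightarrow> real vec) \<Rightarrow> real mat" where
  "design_matrix p n a = mat_of_rows (2 ^ p) (map (\<lambda>i. tensor_vec (a i)) [0..<n])"

definition gram_matrix :: "nat \<Rightarrow> nat \<Rightarrow> (nat \<Rightarrow> real vec) \<Rightarrow> real mat" where
  "gram_matrix p n a = transpose_mat (design_matrix p n a) * design_matrix p n a"

text \<open>Only meaningful if the Gram matrix is invertible (otherwise \<open>mat_inverse\<close> returns \<open>None\<close>).\<close>

definition least_squares :: "nat \<Rightarrow> nat \<Rightarrow> (nat \<Rightarrow> real) \<Rightarrow> (nat \<Rightarrow> real vec) \<Rightarrow> real vec" where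
  "least_squares p n r a =
     the (mat_inverse (gram_matrix p n a)) *\<^sub>v (transpose_mat (design_matrix p n a) *\<^sub>v vec n r)"


subsection \<open>Maximum likelihood\<close>

text \<open>The parameter \<open>(q, b)\<close> stands for the joint law of \<open>(B, A)\<close> under which the tensor vector
  of \<open>A\<close> equals \<open>v\<close> with probability \<open>q v\<close>, for \<open>v\<close> a row of the Sylvester matrix, and
  \<open>B = r\<close> given this event with probability \<open>(1 + r * (b \<bullet> v)) / 2\<close>. The values of \<open>q\<close> at
  vectors that are not rows are irrelevant.\<close>

definition model_params :: "nat \<Rightarrow> ((real vec \<Rightarrow> real) \<times> real vec) set" where
  "model_params p = {(q, b).
     (\<forall>v \<in> set (rows (sylvester p)). 0 \<le> q v) \<and>
     (\<Sum>v \<in> set (rows (sylvester p)). q v) = 1 \<and>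
     b \<in> carrier_vec (2 ^ p) \<and> linf_norm (sylvester p *\<^sub>v b) \<le> 1}"

definition joint_prob :: "(real vec \<Rightarrow> real) \<times> real vec \<Rightarrow> real \<Rightarrow> real vec \<Rightarrow> real" where
  "joint_prob \<theta> r x =
     fst \<theta> (tensor_vec x) * ((1 + r * (snd \<theta> \<bullet> tensor_vec x)) / 2)"

definition likelihood ::
  "nat \<Rightarrow> (nat \<Rightarrow> real) \<Rightarrow> (nat \<Rightarrow> real vec) \<Rightarrow> (real vec \<Rightarrow> real) \<times> real vec \<Rightarrow> real" where
  "likelihood n r a \<theta> = (\<Prod>i<n. joint_prob \<theta> (r i) (a i))"

text \<open>A maximum likelihood estimator of \<open>\<beta>\<close> is the second component of a maximizer of the
  likelihood over all parameters of the joint law.\<close>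

definition is_mle :: "nat \<Rightarrow> nat \<Rightarrow> (nat \<Rightarrow> real) \<Rightarrow> (nat \<Rightarrow> real vec) \<Rightarrow> real vec \<Rightarrow> bool" where
  "is_mle p n r a b \<longleftrightarrow>
     (\<exists>q. (q, b) \<in> model_params p \<and>
        (\<forall>\<theta> \<in> model_params p. likelihood n r a \<theta> \<le> likelihood n r a (q, b)))"


subsection \<open>Conditional expectation and the limiting covariance\<close>

definition cond_exp_given ::
  "nat \<Rightarrow> 'a measure \<Rightarrow> ('a \<Rightarrow> real) \<Rightarrow> ('a \<Rightarrow> real vec) \<Rightarrow> 'a \<Rightarrow> real" where
  "cond_exp_given p M B A =
     real_cond_exp M (vimage_algebra (space M) A (count_space (sign_vecs p))) B"

definition D_matrix :: "nat \<Rightarrow> 'a measure \<Rightarrow> ('a \<Rightarrow> real vec) \<Rightarrow> real vec \<Rightarrow> real mat" where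
  "D_matrix p M A \<beta> = mat_diag (2 ^ p)
     (\<lambda>i. (1 - (\<beta> \<bullet> row (sylvester p) i)\<^sup>2) /
           measure M {\<omega> \<in> space M. tensor_vec (A \<omega>) = row (sylvester p) i})"

definition limit_cov :: "nat \<Rightarrow> 'a measure \<Rightarrow> ('a \<Rightarrow> real vec) \<Rightarrow> real vec \<Rightarrow> real mat" where
  "limit_cov p M A \<beta> =
     (1 / 2 ^ (2 * p)) \<cdot>\<^sub>m (sylvester p * D_matrix p M A \<beta> * sylvester p)"


subsection \<open>Normal laws and convergence in distribution in dimension \<open>N\<close>\<close>

definition normal_law :: "real \<Rightarrow> real \<Rightarrow> real measure" where
  "normal_law m s2 =
     (if s2 = 0 then return borel m
      else density lborel (\<lambda>x. ennreal (normal_density m (sqrt s2) x)))"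

text \<open>Laws on \<open>N\<close>-dimensional space are measures on the finite product of the Borel spaces;
  \<open>vec N x\<close> is the vector with entries \<open>x 0, \<dots>, x (N - 1)\<close>. A law is multivariate normal
  with mean \<open>\<mu>\<close> and covariance \<open>S\<close> if every linear functional is univariate normal with the
  corresponding mean and variance; this determines the law.\<close>

definition mv_normal_law :: "nat \<Rightarrow> real vec \<Rightarrow> real mat \<Rightarrow> (nat \<Rightarrow> real) measure \<Rightarrow> bool" where
  "mv_normal_law N \<mu> S \<nu> \<longleftrightarrow>
     prob_space \<nu> \<and> sets \<nu> = sets (Pi\<^sub>M {..<N} (\<lambda>_. borel)) \<and>
     (\<forall>t \<in> carrier_vec N.
        distr \<nu> borel (\<lambda>x. t \<bullet> vec N x) = normal_law (t \<bullet> \<mu>) (t \<bullet> (S *\<^sub>v t)))"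

text \<open>Since \<open>f (vec N x)\<close> depends only on the first \<open>N\<close> coordinates of \<open>x\<close>, its continuity in
  the product topology is continuity of \<open>f\<close> on \<open>N\<close>-dimensional space.\<close>

definition conv_in_distr ::
  "nat \<Rightarrow> 'a measure \<Rightarrow> (nat \<Rightarrow> 'a \<Rightarrow> real vec) \<Rightarrow> (nat \<Rightarrow> real) measure \<Rightarrow> bool" where
  "conv_in_distr N M X \<nu> \<longleftrightarrow>
     (\<forall>n. \<forall>\<omega>\<in>space M. X n \<omega> \<in> carrier_vec N) \<and>
     (\<forall>n. \<forall>i<N. (\<lambda>\<omega>. X n \<omega> $ i) \<in> borel_measurable M) \<and>
     (\<forall>f :: real vec \<Rightarrow> real.
        continuous_on UNIV (\<lambda>x :: nat \<Rightarrow> real. f (vec N x)) \<longrightarrow>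
        bounded (range (\<lambda>x :: nat \<Rightarrow> real. f (vec N x))) \<longrightarrow>
        (\<lambda>n. \<integral>\<omega>. f (X n \<omega>) \<partial>M) \<longlonglongrightarrow> (\<integral>x. f (vec N x) \<partial>\<nu>))"

end

theory Submission
  imports Defs "HOL-Real_Asymp.Real_Asymp" "Jordan_Normal_Form.Determinant"
begin

text \<open>The rows \<open>v\<close> of the Sylvester matrix are orthogonal, and the tensor vector of a sign vector is
  one of them. Hence \<open>v \<bullet> X\<^sup>T y\<close> is, up to the factor \<open>2 ^ p\<close>, the sum of \<open>y\<close> over the observations in the
  cell of \<open>v\<close>: the Gram matrix is invertible iff every cell is occupied, and then
  \<open>v \<bullet> \<beta>hat\<close> is the mean response in the cell of \<open>v\<close>. In other words \<open>\<beta>hat\<close> reproduces the empirical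
  law of \<open>(B, A)\<close>, which by Gibbs' inequality is the unique maximizer of the likelihood.

  The cell counts \<open>N\<close> and the centred cell sums \<open>T\<close> deviate from their means by \<open>o(n\<^bsup>3/4\<^esup>)\<close> almost
  surely (Hoeffding and Borel--Cantelli). This gives consistency. It also makes the error of replacing
  \<open>\<surd>n T/N\<close> by \<open>T/(\<surd>n P)\<close>, which is a product of two such deviations divided by \<open>n\<^bsup>3/2\<^esup>\<close>, vanish almost
  surely, so that every linear functional of \<open>\<surd>n(\<beta>hat - \<beta>)\<close> inherits the one-dimensional central limit
  theorem. The Cramer-Wold device lifts this to dimension \<open>2 ^ p\<close>.\<close>

subsection \<open>Deviations of bounded independent variables\<close>

text \<open>The exponent 3/4 is the endpoint of an admissible range. For a deviation of order
  \<open>n powr a\<close> Hoeffding's bound has the form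
  \<open>exp (- c * n powr (2 * a - 1))\<close>, which is summable for every a > 1/2, while a
  product of two such deviations divided by \<open>n powr (3/2)\<close> is controlled for a up to
  3/4. The obstacle is the random denominator of the cell means. Because the error of replacing it
  vanishes almost surely, dominated convergence of characteristic functions absorbs that error.
  Uniqueness of \<beta> enters as positivity of every cell probability. Hence almost surely all
  cells are occupied from some sample size on, and the arbitrary values given to the estimator for a
  singular Gram matrix affect no limit. An observation lies in exactly one cell, so the residuals of
  different cells are uncorrelated: in the coordinates given by the rows the limiting covariance is
  diagonal, and the Sylvester matrix divided by \<open>2 ^ p\<close> carries it back. The same
  factorization builds the limit law as a linear image of independent standard normal
  variables.\<close>

lemma (in prob_space) AE_deviation_powr:
  fixes X :: "nat \<Rightarrow> 'a \<Rightarrow> real"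
  assumes indep: "indep_vars (\<lambda>_. borel) X UNIV"
    and bounded: "\<And>i \<omega>. \<omega> \<in> space M \<Longrightarrow> \<bar>X i \<omega>\<bar> \<le> C"
    and mean: "\<And>i. expectation (X i) = \<mu>"
  shows "AE \<omega> in M. (\<lambda>n. ((\<Sum>i<n. X i \<omega>) - real n * \<mu>) / real n powr (3/4)) \<longlonglongrightarrow> 0"
proof -
  have [measurable]: "X i \<in> borel_measurable M" for i
    using indep unfolding indep_vars_def by auto
  \<comment> \<open>\<open>C\<close> may be zero, whereas the sum of squared interval widths in the
    denominator of Hoeffding's bound has to be positive.\<close>
  define c where "c = max C 1"
  have c: "c > 0" unfolding c_def by simp
  define S where "S n \<omega> = (\<Sum>i<n. X i \<omega>) - real n * \<mu>" for n \<omega>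
  have [measurable]: "S n \<in> borel_measurable M" for n
    unfolding S_def by measurable
  have ev: "AE \<omega> in M. eventually (\<lambda>n. \<bar>S n \<omega>\<bar> < \<epsilon> * real n powr (3/4)) sequentially"
    if \<epsilon>: "\<epsilon> > 0" for \<epsilon>
  proof -
    define A where "A n = {\<omega>\<in>space M. \<bar>S n \<omega>\<bar> \<ge> \<epsilon> * real n powr (3/4)}" for n
    have [measurable]: "A n \<in> sets M" for n
      unfolding A_def by measurable
    have le: "measure M (A n) \<le> 2 * exp (- (\<epsilon>\<^sup>2 / (2 * c\<^sup>2)) * sqrt (real n))" if n: "n \<ge> 1" for n
    proof -
      interpret Hoeffding_ineq M "{..<n}" X "\<lambda>_. - c" "\<lambda>_. c" "\<Sum>i<n. expectation (X i)"
      proof unfold_locales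
        show "indep_vars (\<lambda>_. borel) X {..<n}"
          by (rule indep_vars_subset[OF indep]) auto
        show "AE x in M. X i x \<in> {- c..c}" for i
          using bounded[of _ i] unfolding c_def by (intro AE_I2) fastforce
      qed auto
      \<comment> \<open>Each interval has width \<open>2 * c\<close>, so the denominator grows like
        n while the squared deviation grows like n times \<open>sqrt n\<close>; a factor
        \<open>sqrt n\<close> survives in the exponent.\<close>
      have "measure M (A n) \<le> 2 * exp (- 2 * (\<epsilon> * real n powr (3/4))\<^sup>2 / (\<Sum>i<n. (c - - c)\<^sup>2))"
        using Hoeffding_ineq_abs_ge[of "\<epsilon> * real n powr (3/4)"] \<epsilon> c n
        unfolding A_def S_def mean by simp
      also have "(real n powr (3/4))\<^sup>2 = real n * sqrt (real n)"
      proof -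
        have "(real n powr (3/4))\<^sup>2 = real n powr (1 + 1/2)"
          by (simp add: power2_eq_square flip: powr_add)
        then show ?thesis
          using n by (simp only: powr_add powr_half_sqrt) simp
      qed
      then have "- 2 * (\<epsilon> * real n powr (3/4))\<^sup>2 / (\<Sum>i<n. (c - - c)\<^sup>2)
          = - (\<epsilon>\<^sup>2 / (2 * c\<^sup>2)) * sqrt (real n)"
        using n c by (simp add: power_mult_distrib field_simps) 
      finally show ?thesis .
    qed
    have "summable (\<lambda>n. 2 * exp (- (\<epsilon>\<^sup>2 / (2 * c\<^sup>2)) * sqrt (real n)))"
    proof (rule summable_comparison_test_bigo)
      show "summable (\<lambda>n. norm (1 / real n ^ 2))"
        using inverse_power_summable[of 2, where 'a=real] by (simp add: inverse_eq_divide)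
      have "(\<lambda>n. 2 * exp (- a * sqrt (real n))) \<in> O(\<lambda>n. 1 / real n ^ 2)" if "a > 0" for a
        using that by real_asymp
      then show "(\<lambda>n. 2 * exp (- (\<epsilon>\<^sup>2 / (2 * c\<^sup>2)) * sqrt (real n))) \<in> O(\<lambda>n. 1 / real n ^ 2)"
        using c \<epsilon> by (metis divide_pos_pos mult_pos_pos zero_less_numeral zero_less_power)
    qed
    then have "summable (\<lambda>n. measure M (A n))"
      by (rule summable_comparison_test'[where N = 1]) (use le in auto)
    then have "AE \<omega> in M. eventually (\<lambda>n. \<omega> \<in> space M - A n) sequentially"
      by (intro borel_cantelli_AE1) (auto simp: emeasure_eq_measure)
    then show ?thesis
      by (rule eventually_mono) (auto simp: A_def not_le elim!: eventually_mono)
  qed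
  \<comment> \<open>The tolerances are restricted to the values \<open>1 / Suc k\<close> so that
    only countably many null sets are united.\<close>
  have "AE \<omega> in M. \<forall>k. eventually (\<lambda>n. \<bar>S n \<omega>\<bar> < (1 / real (Suc k)) * real n powr (3/4)) sequentially"
    unfolding AE_all_countable by (intro allI ev) simp
  then show ?thesis
  proof (rule eventually_mono)
    fix \<omega>
    assume *: "\<forall>k. eventually (\<lambda>n. \<bar>S n \<omega>\<bar> < (1 / real (Suc k)) * real n powr (3/4)) sequentially"
    show "(\<lambda>n. ((\<Sum>i<n. X i \<omega>) - real n * \<mu>) / real n powr (3/4)) \<longlonglongrightarrow> 0"
      unfolding S_def[symmetric]
    proof (rule tendstoI)
      fix e :: real
      assume "e > 0"
      then obtain k where k: "1 / real (Suc k) < e"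
        using nat_approx_posE by blast
      show "eventually (\<lambda>n. dist (S n \<omega> / real n powr (3/4)) 0 < e) sequentially"
        using *[rule_format, of k] eventually_gt_at_top[of 0]
      proof eventually_elim
        case (elim n)
        then have "\<bar>S n \<omega>\<bar> / real n powr (3/4) < 1 / real (Suc k)"
          by (subst pos_divide_less_eq) auto
        then show ?case using k by (simp add: dist_norm abs_divide)
      qed
    qed
  qed
qed

text \<open>These are deterministic sequences: the lemma is applied outcome by outcome, with
  \<open>N\<close> a cell count, \<open>P\<close> the cell probability and \<open>T\<close> the
  centred cell sum.\<close>

lemma ratio_asymptotics:
  fixes N T :: "nat \<Rightarrow> real"
  assumes "P > 0"
    and N: "(\<lambda>n. (N n - real n * P) / real n powr (3/4)) \<longlonglongrightarrow> 0"
    and T: "(\<lambda>n. T n / real n powr (3/4)) \<longlonglongrightarrow> 0"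
  shows "eventually (\<lambda>n. N n > 0) sequentially"
    and "(\<lambda>n. T n / N n) \<longlonglongrightarrow> 0"
    and "(\<lambda>n. sqrt (real n) * (T n / N n) - T n / sqrt (real n) / P) \<longlonglongrightarrow> 0"
proof -
  have scale: "(\<lambda>n. real n powr (3/4) / real n) \<longlonglongrightarrow> 0"
    by real_asymp
  have "(\<lambda>n. (N n - real n * P) / real n powr (3/4) * (real n powr (3/4) / real n) + P) \<longlonglongrightarrow> 0 * 0 + P"
    by (intro tendsto_intros N scale)
  moreover have "eventually (\<lambda>n. (N n - real n * P) / real n powr (3/4) * (real n powr (3/4) / real n) + P = N n / real n) sequentially"
    using eventually_gt_at_top[of 0] by eventually_elim (simp add: field_simps)
  ultimately have "(\<lambda>n. N n / real n) \<longlonglongrightarrow> 0 * 0 + P"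
    by (rule Lim_transform_eventually)
  then have N_over: "(\<lambda>n. N n / real n) \<longlonglongrightarrow> P"
    by simp
  have "eventually (\<lambda>n. N n / real n > 0) sequentially"
    using order_tendstoD(1)[OF N_over \<open>P > 0\<close>] .
  then show pos: "eventually (\<lambda>n. N n > 0) sequentially"
    using eventually_gt_at_top[of 0] by eventually_elim (simp add: zero_less_divide_iff)
  have "(\<lambda>n. T n / real n powr (3/4) * (real n powr (3/4) / real n) / (N n / real n)) \<longlonglongrightarrow> 0 * 0 / P"
    using \<open>P > 0\<close> by (intro tendsto_intros T scale N_over) simp
  moreover have "eventually (\<lambda>n. T n / real n powr (3/4) * (real n powr (3/4) / real n) / (N n / real n) = T n / N n) sequentially"
    using eventually_gt_at_top[of 0] by eventually_elim simp
  ultimately have "(\<lambda>n. T n / N n) \<longlonglongrightarrow> 0 * 0 / P"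
    by (rule Lim_transform_eventually)
  then show "(\<lambda>n. T n / N n) \<longlonglongrightarrow> 0"
    by simp
  \<comment> \<open>The error equals \<open>T * (n * P - N) / (sqrt n * N * P)\<close> exactly.
    Distributing \<open>n powr (3/2)\<close> over the two deviations leaves the factor n / N, which
    tends to 1 / P.\<close>
  have "(\<lambda>n. T n / real n powr (3/4) * - ((N n - real n * P) / real n powr (3/4)) / (N n / real n) / P) \<longlonglongrightarrow> 0 * - 0 / P / P"
    using \<open>P > 0\<close> by (intro tendsto_intros T N N_over) auto
  moreover have "eventually (\<lambda>n. T n / real n powr (3/4) * - ((N n - real n * P) / real n powr (3/4)) / (N n / real n) / P
      = sqrt (real n) * (T n / N n) - T n / sqrt (real n) / P) sequentially"
    using pos eventually_gt_at_top[of 0]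
  proof eventually_elim
    case (elim n)
    \<comment> \<open>Expressing n and \<open>n powr (3/2)\<close> through \<open>s\<close> turns
      the identity into one between rational functions.\<close>
    define s where "s = sqrt (real n)"
    have s: "s > 0" "real n = s * s" using elim by (simp_all add: s_def)
    have "real n powr (3/4) * real n powr (3/4) = real n powr (1 + 1/2)"
      by (simp flip: powr_add)
    also have "\<dots> = s * s * s"
      using elim by (simp only: powr_add powr_half_sqrt) (simp add: s_def)
    finally have eq: "T n / real n powr (3/4) * - ((N n - real n * P) / real n powr (3/4)) = T n * (real n * P - N n) / (s * s * s)"
      by (simp only: times_divide_times_eq minus_divide_left minus_diff_eq)
    then show ?case
      unfolding eq s_def[symmetric] unfolding s(2) using elim(1) s(1) \<open>P > 0\<close> by (simp add: field_simps)
  qed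
  ultimately have "(\<lambda>n. sqrt (real n) * (T n / N n) - T n / sqrt (real n) / P) \<longlonglongrightarrow> 0 * - 0 / P / P"
    by (rule Lim_transform_eventually)
  then show "(\<lambda>n. sqrt (real n) * (T n / N n) - T n / sqrt (real n) / P) \<longlonglongrightarrow> 0"
    by simp
qed

subsection \<open>Weak convergence and normal laws on the real line\<close>

text \<open>A form of Slutsky's lemma. The two integrands \<open>iexp (s * (W + D))\<close> and
  \<open>iexp (s * W)\<close> differ in modulus by \<open>iexp (s * D) - 1\<close>, which is at most
  2 and tends to 0 almost surely; so the characteristic functions have the same limit and Levy's
  continuity theorem applies.\<close>

lemma (in prob_space) weak_conv_m_add_AE_null:
  fixes W D :: "nat \<Rightarrow> 'a \<Rightarrow> real"
  assumes [measurable]: "\<And>n. W n \<in> borel_measurable M" "\<And>n. D n \<in> borel_measurable M"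
    and \<mu>: "real_distribution \<mu>"
    and conv: "weak_conv_m (\<lambda>n. distr M borel (W n)) \<mu>"
    and null: "AE \<omega> in M. (\<lambda>n. D n \<omega>) \<longlonglongrightarrow> 0"
  shows "weak_conv_m (\<lambda>n. distr M borel (\<lambda>\<omega>. W n \<omega> + D n \<omega>)) \<mu>"
proof (rule levy_continuity)
  show "real_distribution (distr M borel (\<lambda>\<omega>. W n \<omega> + D n \<omega>))" for n
    by simp
  have rdW: "real_distribution (distr M borel (W n))" for n
    by simp
  fix s :: real
  have "(\<lambda>n. \<integral>\<omega>. iexp (s * (W n \<omega> + D n \<omega>)) - iexp (s * W n \<omega>) \<partial>M) \<longlonglongrightarrow> (\<integral>\<omega>. 0 \<partial>M)"
  proof (rule integral_dominated_convergence[where w = "\<lambda>_. 2"])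
    have le: "norm (iexp (s * (W n \<omega> + D n \<omega>)) - iexp (s * W n \<omega>)) = norm (iexp (s * D n \<omega>) - 1)" for n \<omega>
    proof -
      have "iexp (s * (W n \<omega> + D n \<omega>)) - iexp (s * W n \<omega>) = iexp (s * W n \<omega>) * (iexp (s * D n \<omega>) - 1)"
        by (simp add: algebra_simps exp_add)
      then show ?thesis by (simp add: norm_mult)
    qed
    show "AE \<omega> in M. (\<lambda>n. iexp (s * (W n \<omega> + D n \<omega>)) - iexp (s * W n \<omega>)) \<longlonglongrightarrow> 0"
      using null
    proof (rule eventually_mono)
      fix \<omega> assume "(\<lambda>n. D n \<omega>) \<longlonglongrightarrow> 0"
      then have "(\<lambda>n. iexp (s * D n \<omega>) - 1) \<longlonglongrightarrow> iexp (s * 0) - 1"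
        by (intro tendsto_intros)
      then have "(\<lambda>n. norm (iexp (s * D n \<omega>) - 1)) \<longlonglongrightarrow> 0"
        by (intro tendsto_norm_zero) simp
      then show "(\<lambda>n. iexp (s * (W n \<omega> + D n \<omega>)) - iexp (s * W n \<omega>)) \<longlonglongrightarrow> 0"
        unfolding le[symmetric] by (rule tendsto_norm_zero_cancel)
    qed
    show "AE \<omega> in M. norm (iexp (s * (W n \<omega> + D n \<omega>)) - iexp (s * W n \<omega>)) \<le> 2" for n
      by (intro AE_I2 order_trans[OF norm_triangle_ineq4]) simp
  qed auto
  moreover have "(\<integral>\<omega>. iexp (s * (W n \<omega> + D n \<omega>)) - iexp (s * W n \<omega>) \<partial>M)
      = char (distr M borel (\<lambda>\<omega>. W n \<omega> + D n \<omega>)) s - char (distr M borel (W n)) s" for n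
  proof -
    have "integrable M (\<lambda>\<omega>. iexp (s * V \<omega>))" if [measurable]: "V \<in> borel_measurable M" for V
      by (rule integrable_const_bound[where B = 1]) auto
    from this[of "\<lambda>\<omega>. W n \<omega> + D n \<omega>"] this[of "W n"] show ?thesis
      unfolding char_def by (simp add: integral_distr Bochner_Integration.integral_diff)
  qed
  ultimately have "(\<lambda>n. char (distr M borel (\<lambda>\<omega>. W n \<omega> + D n \<omega>)) s - char (distr M borel (W n)) s) \<longlonglongrightarrow> 0"
    by simp
  from tendsto_add[OF this levy_continuity1[OF rdW \<mu> conv, of s]]
  show "(\<lambda>n. char (distr M borel (\<lambda>\<omega>. W n \<omega> + D n \<omega>)) s) \<longlonglongrightarrow> char \<mu> s"
    by simp
qed (fact \<mu>)

text \<open>This serves to undo the division by the standard deviation in the central limit theorem.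
  Scaling by \<open>c\<close> evaluates characteristic functions at \<open>s * c\<close>.\<close>

lemma (in prob_space) weak_conv_m_mult:
  fixes W :: "nat \<Rightarrow> 'a \<Rightarrow> real"
  assumes [measurable]: "\<And>n. W n \<in> borel_measurable M"
    and \<mu>: "real_distribution \<mu>"
    and conv: "weak_conv_m (\<lambda>n. distr M borel (W n)) \<mu>"
  shows "weak_conv_m (\<lambda>n. distr M borel (\<lambda>\<omega>. c * W n \<omega>)) (distr \<mu> borel (\<lambda>x. c * x))"
proof (rule levy_continuity)
  interpret \<mu>: real_distribution \<mu> by (rule \<mu>)
  show "real_distribution (distr M borel (\<lambda>\<omega>. c * W n \<omega>))" for n
    by simp
  show "real_distribution (distr \<mu> borel (\<lambda>x. c * x))"
    by simp
  fix s :: real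
  have "char (distr M borel (\<lambda>\<omega>. c * W n \<omega>)) s = char (distr M borel (W n)) (s * c)" for n
    unfolding char_def by (simp add: integral_distr mult.assoc)
  moreover have "char (distr \<mu> borel (\<lambda>x. c * x)) s = char \<mu> (s * c)"
    unfolding char_def by (simp add: integral_distr mult.assoc)
  moreover have "(\<lambda>n. char (distr M borel (W n)) (s * c)) \<longlonglongrightarrow> char \<mu> (s * c)"
    by (rule levy_continuity1[OF _ \<mu> conv]) simp
  ultimately show "(\<lambda>n. char (distr M borel (\<lambda>\<omega>. c * W n \<omega>)) s) \<longlonglongrightarrow> char (distr \<mu> borel (\<lambda>x. c * x)) s"
    by simp
qed

lemma real_distribution_normal_law: "0 \<le> s \<Longrightarrow> real_distribution (normal_law m s)"
  unfolding normal_law_def real_distribution_def real_distribution_axioms_def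
  by (auto simp: prob_space_return prob_space_normal_density)

text \<open>The coordinates of a product measure are independent, and independent centred normal
  variables add their variances. All one-dimensional projections of the limit law are computed from
  this.\<close>

lemma distr_std_normal_linear_combination:
  fixes c :: "'i \<Rightarrow> real"
  assumes "finite I"
  shows "distr (\<Pi>\<^sub>M i\<in>I. std_normal_distribution) borel (\<lambda>x. \<Sum>i\<in>I. c i * x i)
    = normal_law 0 (\<Sum>i\<in>I. (c i)\<^sup>2)"
proof -
  let ?P = "\<Pi>\<^sub>M i\<in>I. std_normal_distribution"
  interpret prob_space ?P
    by (intro prob_space_PiM) (simp add: prob_space_normal_density)
  \<comment> \<open>A zero coefficient gives a degenerate summand without a normal density, so such
    indices are discarded. If none remains, the law is the point mass that \<open>normal_law\<close>
    assigns to variance 0.\<close>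
  define J where "J = {i\<in>I. c i \<noteq> 0}"
  have sums: "(\<Sum>i\<in>I. c i * x i) = (\<Sum>i\<in>J. c i * x i)" "(\<Sum>i\<in>I. (c i)\<^sup>2) = (\<Sum>i\<in>J. (c i)\<^sup>2)" for x
    unfolding J_def using assms by (auto intro!: sum.mono_neutral_right)
  show ?thesis
  proof (cases "J = {}")
    case True
    then show ?thesis
      unfolding sums by (simp add: normal_law_def)
  next
    case False
    have J: "finite J" "J \<subseteq> I" unfolding J_def using assms by auto
    with False have I: "I \<noteq> {}" by auto
    have comp: "distr ?P borel (\<lambda>x. x i) = std_normal_distribution" if "i \<in> I" for i
      using distr_PiM_component[of I "\<lambda>_. std_normal_distribution" i] that assms
      by (simp add: prob_space_normal_density cong: distr_cong)
    have "indep_vars (\<lambda>_. std_normal_distribution) (\<lambda>i x. x i) I"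
    proof (subst indep_vars_iff_distr_eq_PiM'[OF I])
      show "distr ?P (\<Pi>\<^sub>M i\<in>I. std_normal_distribution) (\<lambda>x. \<lambda>i\<in>I. x i) =
        (\<Pi>\<^sub>M i\<in>I. distr ?P std_normal_distribution (\<lambda>x. x i))"
      proof -
        have "distr ?P ?P (\<lambda>x. \<lambda>i\<in>I. x i) = distr ?P ?P (\<lambda>x. x)"
          by (rule distr_cong) (auto simp: space_PiM PiE_restrict)
        also have "\<dots> = ?P" by simp
        also have "\<dots> = (\<Pi>\<^sub>M i\<in>I. distr ?P std_normal_distribution (\<lambda>x. x i))"
          using comp by (intro PiM_cong) (simp_all cong: distr_cong)
        finally show ?thesis .
      qed
    qed simp
    then have "indep_vars (\<lambda>_. borel) (\<lambda>i x. c i * x i) I"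
      by (rule indep_vars_compose2) simp
    then have ind: "indep_vars (\<lambda>_. borel) (\<lambda>i x. c i * x i) J"
      by (rule indep_vars_subset) (fact J)
    have "distributed ?P lborel (\<lambda>x. \<Sum>i\<in>J. c i * x i)
        (normal_density (\<Sum>i\<in>J. 0) (sqrt (\<Sum>i\<in>J. \<bar>c i\<bar>\<^sup>2)))"
    proof (rule sum_indep_normal[OF J(1) False ind])
      fix i assume i: "i \<in> J"
      then show "0 < \<bar>c i\<bar>" unfolding J_def by simp
      have "distributed ?P lborel (\<lambda>x. x i) std_normal_density"
        using comp[of i] i J unfolding distributed_def by (auto cong: distr_cong)
      from normal_density_affine[OF this, of "c i" 0] i
      show "distributed ?P lborel (\<lambda>x. c i * x i) (\<lambda>x. ennreal (normal_density 0 \<bar>c i\<bar> x))"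
        unfolding J_def by simp
    qed
    then have "distr ?P borel (\<lambda>x. \<Sum>i\<in>J. c i * x i) = density lborel (normal_density 0 (sqrt (\<Sum>i\<in>J. (c i)\<^sup>2)))"
      unfolding distributed_def by (simp cong: distr_cong)
    moreover have "(\<Sum>i\<in>J. (c i)\<^sup>2) > 0"
      using J False by (intro sum_pos) (auto simp: J_def)
    ultimately show ?thesis
      unfolding sums by (simp add: normal_law_def)
  qed
qed

lemma distr_std_normal_mult:
  assumes "\<sigma> > 0"
  shows "distr std_normal_distribution borel (\<lambda>x. \<sigma> * x) = normal_law 0 (\<sigma>\<^sup>2)"
proof -
  interpret prob_space std_normal_distribution
    by (simp add: prob_space_normal_density)
  have "distr std_normal_distribution lborel (\<lambda>x. x) = std_normal_distribution"
    by (rule distr_id2) simp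
  then have "distributed std_normal_distribution lborel (\<lambda>x. x) std_normal_density"
    unfolding distributed_def by simp
  from normal_density_affine[OF this, of \<sigma> 0] assms
  have "distr std_normal_distribution lborel (\<lambda>x. \<sigma> * x) = density lborel (normal_density 0 \<sigma>)"
    unfolding distributed_def by simp
  then show ?thesis
    using assms unfolding normal_law_def by (simp cong: distr_cong)
qed

text \<open>Variance 0 is included because the Cramer-Wold hypothesis ranges over all linear
  functionals, the zero functional among them. In that case all summands vanish almost surely and
  every normalized sum has the law of the constant 0.\<close>

lemma (in prob_space) central_limit_theorem_normal_law:
  fixes X :: "nat \<Rightarrow> 'a \<Rightarrow> real"
  assumes indep: "indep_vars (\<lambda>_. borel) X UNIV"
    and mean: "\<And>n. expectation (X n) = 0"
    and square_int: "\<And>n. integrable M (\<lambda>\<omega>. (X n \<omega>)\<^sup>2)"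
    and var: "\<And>n. expectation (\<lambda>\<omega>. (X n \<omega>)\<^sup>2) = s2"
    and distr: "\<And>n. distr M borel (X n) = \<mu>"
  shows "weak_conv_m (\<lambda>n. distr M borel (\<lambda>\<omega>. (\<Sum>i<n. X i \<omega>) / sqrt (real n))) (normal_law 0 s2)"
proof -
  have [measurable]: "X i \<in> borel_measurable M" for i
    using indep unfolding indep_vars_def by auto
  have "s2 \<ge> 0"
    unfolding var[of 0, symmetric] by (rule Bochner_Integration.integral_nonneg) simp
  then consider "s2 = 0" | "s2 > 0" by linarith
  then show ?thesis
  proof cases
    case 1
    have "AE \<omega> in M. X i \<omega> = 0" for i
      using integral_nonneg_eq_0_iff_AE[OF square_int[of i]] var[of i] 1 by simp
    then have "AE \<omega> in M. \<forall>i. X i \<omega> = 0"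
      unfolding AE_all_countable by simp
    then have "distr M borel (\<lambda>\<omega>. (\<Sum>i<n. X i \<omega>) / sqrt (real n)) = distr M borel (\<lambda>\<omega>. 0)" for n
      by (intro distr_cong_AE) (auto elim!: eventually_mono)
    then show ?thesis
      unfolding 1 weak_conv_m_def weak_conv_def by (simp add: normal_law_def)
  next
    case 2
    define \<sigma> where "\<sigma> = sqrt s2"
    have \<sigma>: "\<sigma> > 0" "\<sigma>\<^sup>2 = s2" using 2 unfolding \<sigma>_def by simp_all
    have "weak_conv_m (\<lambda>n. distr M borel (\<lambda>\<omega>. (\<Sum>i<n. X i \<omega>) / sqrt (real n * \<sigma>\<^sup>2))) std_normal_distribution"
      by (rule central_limit_theorem_zero_mean[OF indep mean \<sigma>(1) square_int _ distr])
        (use mean var \<sigma> in simp)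
    from weak_conv_m_mult[OF _ _ this, of \<sigma>]
    have "weak_conv_m (\<lambda>n. distr M borel (\<lambda>\<omega>. \<sigma> * ((\<Sum>i<n. X i \<omega>) / sqrt (real n * \<sigma>\<^sup>2)))) (normal_law 0 s2)"
      using distr_std_normal_mult[OF \<sigma>(1)] \<sigma>(2) real_dist_normal_dist by simp
    moreover have "\<sigma> * (x / sqrt (real n * \<sigma>\<^sup>2)) = x / sqrt (real n)" for x n
      using \<sigma>(1) by (simp add: real_sqrt_mult)
    ultimately show ?thesis by simp
  qed
qed

subsection \<open>The Cramer-Wold device\<close>

text \<open>Real trigonometric polynomials in the first \<open>N\<close> coordinates, with arbitrary
  real frequencies. Each wave is a bounded continuous function of a single linear functional, so
  one-dimensional weak convergence already controls its expectation. The phase \<open>d\<close>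
  makes sines available and keeps the family closed under products.\<close>

inductive_set trig_sums :: "nat \<Rightarrow> ((nat \<Rightarrow> real) \<Rightarrow> real) set" for N where
  wave: "(\<lambda>x. c * cos ((\<Sum>i<N. t i * x i) + d)) \<in> trig_sums N"
| add: "f \<in> trig_sums N \<Longrightarrow> g \<in> trig_sums N \<Longrightarrow> (\<lambda>x. f x + g x) \<in> trig_sums N"

lemma trig_sums_const: "(\<lambda>x. c) \<in> trig_sums N"
  using wave[where c = c and t = "\<lambda>_. 0" and d = 0] by simp

lemma trig_sums_sin_coordinate:
  assumes "i < N"
  shows "(\<lambda>x. sin (a * x i)) \<in> trig_sums N"
proof -
  \<comment> \<open>The sign of the frequency comes from writing \<open>sin b\<close> as
    \<open>cos (pi / 2 - b)\<close>.\<close>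
  have sum: "(\<Sum>j<N. (if j = i then - a else 0) * x j) = - (a * x i)" for x :: "nat \<Rightarrow> real"
    using assms by (simp add: if_distrib if_distribR cong: if_cong)
  have sin: "1 * cos (- b + pi / 2) = sin b" for b :: real
    using cos_diff[of "pi / 2" b] by simp
  have "(\<lambda>x. 1 * cos ((\<Sum>j<N. (if j = i then - a else 0) * x j) + pi / 2)) \<in> trig_sums N"
    by (rule wave)
  then show ?thesis
    unfolding sum sin .
qed

text \<open>The product-to-sum formula replaces a product of two waves by waves with the difference
  and the sum of their frequencies and phases; both inductions then only distribute products over
  sums. This makes the family an algebra, as Stone--Weierstrass requires.\<close>

lemma trig_sums_mult:
  assumes "f \<in> trig_sums N" "g \<in> trig_sums N"
  shows "(\<lambda>x. f x * g x) \<in> trig_sums N"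
  using assms
proof induction
  case (wave c t d)
  from \<open>g \<in> trig_sums N\<close> show ?case
  proof induction
    case (wave c' t' d')
    have "(\<lambda>x. c * cos ((\<Sum>i<N. t i * x i) + d) * (c' * cos ((\<Sum>i<N. t' i * x i) + d'))) =
      (\<lambda>x. c * c' / 2 * cos ((\<Sum>i<N. (t i - t' i) * x i) + (d - d')) +
           c * c' / 2 * cos ((\<Sum>i<N. (t i + t' i) * x i) + (d + d')))"
    proof
      fix x :: "nat \<Rightarrow> real"
      let ?u = "(\<Sum>i<N. t i * x i) + d" and ?v = "(\<Sum>i<N. t' i * x i) + d'"
      have "(\<Sum>i<N. (t i - t' i) * x i) + (d - d') = ?u - ?v"
        "(\<Sum>i<N. (t i + t' i) * x i) + (d + d') = ?u + ?v"
        by (simp_all add: left_diff_distrib distrib_right sum_subtractf sum.distrib)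
      then show "c * cos ?u * (c' * cos ?v) =
        c * c' / 2 * cos ((\<Sum>i<N. (t i - t' i) * x i) + (d - d')) +
        c * c' / 2 * cos ((\<Sum>i<N. (t i + t' i) * x i) + (d + d'))"
        by (simp only: mult.left_commute[of _ c'] mult.assoc cos_times_cos) (simp add: algebra_simps add_divide_distrib)
    qed
    then show ?case
      by (simp only:) (intro trig_sums.intros)
  next
    case (add g h)
    then show ?case by (simp add: distrib_left trig_sums.add)
  qed
next
  case (add f h)
  then show ?case by (simp add: distrib_right trig_sums.add)
qed

lemma trig_sums_bounded:
  assumes "f \<in> trig_sums N"
  shows "\<exists>C. \<forall>x. \<bar>f x\<bar> \<le> C"
  using assms
proof induction
  case (wave c t d)
  have "\<bar>c * cos a\<bar> \<le> \<bar>c\<bar>" for a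
    by (simp add: abs_mult mult_left_le)
  then show ?case by blast
next
  case (add f g)
  then obtain C D where "\<forall>x. \<bar>f x\<bar> \<le> C" "\<forall>x. \<bar>g x\<bar> \<le> D" by auto
  then have "\<bar>f x + g x\<bar> \<le> C + D" for x
    by (meson abs_triangle_ineq add_mono order_trans)
  then show ?case by blast
qed

lemma trig_sums_measurable:
  assumes "f \<in> trig_sums N" and [measurable]: "\<And>i. (\<lambda>\<omega>. Z \<omega> i) \<in> borel_measurable L"
  shows "(\<lambda>\<omega>. f (Z \<omega>)) \<in> borel_measurable L"
  using assms(1) by induction auto

lemma trig_sums_integrable:
  assumes "prob_space L" "f \<in> trig_sums N" "\<And>i. (\<lambda>\<omega>. Z \<omega> i) \<in> borel_measurable L"
  shows "integrable L (\<lambda>\<omega>. f (Z \<omega>))"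
proof -
  interpret prob_space L by fact
  obtain C where "\<forall>x. \<bar>f x\<bar> \<le> C" using trig_sums_bounded[OF assms(2)] ..
  then show ?thesis
    by (intro integrable_const_bound[where B = C] trig_sums_measurable[OF assms(2,3)]) auto
qed

text \<open>Substituting \<open>R arcsin (sin (x\<^sub>i / R))\<close> for \<open>x\<^sub>i\<close> leaves \<open>f\<close> unchanged on a cube and turns it into a
  continuous function of the sines, so that Stone--Weierstrass on \<open>[-1, 1]\<^sup>N\<close> yields an approximation by
  trigonometric sums which is uniform on the whole space.\<close>

lemma trig_sums_approx:
  fixes f :: "(nat \<Rightarrow> real) \<Rightarrow> real"
  assumes cont: "continuous_on UNIV f"
    and coords: "\<And>x y. (\<And>i. i < N \<Longrightarrow> x i = y i) \<Longrightarrow> f x = f y"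
    and "\<epsilon> > 0" "R > 0"
  obtains g where "g \<in> trig_sums N"
    "\<And>x. \<bar>f (\<lambda>i. R * arcsin (sin (x i / R))) - g x\<bar> < \<epsilon>"
proof -
  \<comment> \<open>The coordinates from \<open>N\<close> on are frozen at 0. This keeps the set
    compact in the infinite product, and distinct points already differ in one of the first
    \<open>N\<close> coordinates.\<close>
  define S where "S = {s :: nat \<Rightarrow> real. \<forall>i. s i \<in> (if i < N then {-1..1} else {0})}"
  define w where "w x = (\<lambda>i. if i < N then sin (x i / R) else 0)" for x :: "nat \<Rightarrow> real"
  have S_D: "s i \<in> (if i < N then {-1..1} else {0})" if "s \<in> S" for s i
    using that unfolding S_def by blast
  have S_bounds: "- 1 \<le> s i" "s i \<le> 1" if "s \<in> S" for s i
    using S_D[OF that, of i] by (auto split: if_splits)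
  have wS: "w x \<in> S" for x
    unfolding w_def S_def by simp
  \<comment> \<open>The approximating algebra lives on the compact set, but membership is tested
    after substituting the sines: an approximant on \<open>S\<close> is then automatically a
    trigonometric sum on the whole space.\<close>
  define \<R> where "\<R> = {h. continuous_on S h \<and> (\<lambda>x. h (w x)) \<in> trig_sums N}"
  have "compact S"
  proof -
    define K where "K i = (if i < N then {-1..1} else {0 :: real})" for i
    have "S = PiE UNIV K"
      unfolding S_def K_def PiE_UNIV_domain Pi_def by blast
    moreover have "compactin (product_topology (\<lambda>_. euclidean) UNIV) (PiE UNIV K)"
      unfolding compactin_PiE by (simp add: K_def)
    ultimately show ?thesis
      by (simp add: euclidean_product_topology)
  qed
  interpret function_ring_on \<R> S
  proof
    show "compact S" by fact
    show "continuous_on S h" if "h \<in> \<R>" for h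
      using that unfolding \<R>_def by simp
    show "(\<lambda>x. h x + k x) \<in> \<R>" "(\<lambda>x. h x * k x) \<in> \<R>" if "h \<in> \<R>" "k \<in> \<R>" for h k
      using that unfolding \<R>_def
      by (auto intro: continuous_on_add continuous_on_mult trig_sums.add trig_sums_mult)
    show "(\<lambda>_. c) \<in> \<R>" for c
      unfolding \<R>_def by (simp add: trig_sums_const)
    fix x y :: "nat \<Rightarrow> real"
    assume "x \<in> S" "y \<in> S" "x \<noteq> y"
    then obtain i where i: "x i \<noteq> y i"
      by (auto simp: fun_eq_iff)
    with S_D[OF \<open>x \<in> S\<close>, of i] S_D[OF \<open>y \<in> S\<close>, of i] have "i < N"
      by (auto split: if_splits)
    have "(\<lambda>s. s i) \<in> \<R>"
      using trig_sums_sin_coordinate[OF \<open>i < N\<close>, of "1 / R"] \<open>i < N\<close>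
      by (auto simp: \<R>_def w_def intro: continuous_on_product_coordinates continuous_on_subset)
    with i show "\<exists>f\<in>\<R>. f x \<noteq> f y"
      by (intro bexI[of _ "\<lambda>s. s i"])
  qed
  have "continuous_on S (\<lambda>s. f (\<lambda>i. R * arcsin (s i)))"
  proof (rule continuous_on_compose2[OF cont])
    show "continuous_on S (\<lambda>s i. R * arcsin (s i))"
      by (intro continuous_on_coordinatewise_then_product continuous_intros
          continuous_on_subset[OF continuous_on_product_coordinates])
        (use S_bounds in blast)+
  qed simp
  from Stone_Weierstrass_basic[OF this \<open>\<epsilon> > 0\<close>]
  obtain h where h: "h \<in> \<R>" "\<And>s. s \<in> S \<Longrightarrow> \<bar>f (\<lambda>i. R * arcsin (s i)) - h s\<bar> < \<epsilon>"
    by blast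
  show ?thesis
  proof
    show "(\<lambda>x. h (w x)) \<in> trig_sums N"
      using h(1) unfolding \<R>_def by simp
    fix x
    have "f (\<lambda>i. R * arcsin (sin (x i / R))) = f (\<lambda>i. R * arcsin (w x i))"
      by (rule coords) (simp add: w_def)
    then show "\<bar>f (\<lambda>i. R * arcsin (sin (x i / R))) - h (w x)\<bar> < \<epsilon>"
      using h(2)[OF wS] by simp
  qed
qed

text \<open>The function \<open>f\<close> is replaced by a trigonometric sum \<open>g\<close>, for
  which convergence holds by linearity. Inside a large cube the error is uniformly small; outside it
  is bounded by about \<open>2 * C\<close>, and the mass there is measured by \<open>H\<close>, a
  sum of functions of single coordinates whose expectations also converge by the one-dimensional
  hypothesis.\<close>

theorem Cramer_Wold:
  fixes X :: "nat \<Rightarrow> 'a \<Rightarrow> nat \<Rightarrow> real" and Y :: "'b \<Rightarrow> nat \<Rightarrow> real"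
    and f :: "(nat \<Rightarrow> real) \<Rightarrow> real"
  assumes "prob_space M" "prob_space L"
    and X [measurable]: "\<And>n i. (\<lambda>\<omega>. X n \<omega> i) \<in> borel_measurable M"
    and Y [measurable]: "\<And>i. (\<lambda>\<omega>. Y \<omega> i) \<in> borel_measurable L"
    and conv: "\<And>t. weak_conv_m (\<lambda>n. distr M borel (\<lambda>\<omega>. \<Sum>i<N. t i * X n \<omega> i))
                      (distr L borel (\<lambda>\<omega>. \<Sum>i<N. t i * Y \<omega> i))"
    and cont: "continuous_on UNIV f" and bdd: "bounded (range f)"
    and coords: "\<And>x y. (\<And>i. i < N \<Longrightarrow> x i = y i) \<Longrightarrow> f x = f y"
  shows "(\<lambda>n. \<integral>\<omega>. f (X n \<omega>) \<partial>M) \<longlonglongrightarrow> (\<integral>\<omega>. f (Y \<omega>) \<partial>L)"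
proof -
  interpret M: prob_space M by fact
  interpret L: prob_space L by fact
  have conv1: "(\<lambda>n. \<integral>\<omega>. h (\<Sum>i<N. t i * X n \<omega> i) \<partial>M) \<longlonglongrightarrow> (\<integral>\<omega>. h (\<Sum>i<N. t i * Y \<omega> i) \<partial>L)"
    if h: "continuous_on UNIV h" "\<And>x. \<bar>h x\<bar> \<le> C" for h :: "real \<Rightarrow> real" and C t
  proof -
    have [measurable]: "h \<in> borel_measurable borel"
      by (rule borel_measurable_continuous_onI[OF h(1)])
    have "(\<lambda>n. integral\<^sup>L (distr M borel (\<lambda>\<omega>. \<Sum>i<N. t i * X n \<omega> i)) h)
        \<longlonglongrightarrow> integral\<^sup>L (distr L borel (\<lambda>\<omega>. \<Sum>i<N. t i * Y \<omega> i)) h"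
      by (rule weak_conv_imp_integral_bdd_continuous_conv[OF _ _ conv, where B = C])
        (use h in \<open>auto simp: continuous_on_eq_continuous_at\<close>)
    then show ?thesis by (simp add: integral_distr)
  qed
  have trig_int: "integrable M (\<lambda>\<omega>. g (X n \<omega>))" "integrable L (\<lambda>\<omega>. g (Y \<omega>))"
    if "g \<in> trig_sums N" for g n
    using that by (intro trig_sums_integrable assms; simp)+
  have conv_trig: "(\<lambda>n. \<integral>\<omega>. g (X n \<omega>) \<partial>M) \<longlonglongrightarrow> (\<integral>\<omega>. g (Y \<omega>) \<partial>L)"
    if "g \<in> trig_sums N" for g
    using that
  proof induction
    case (wave c t d)
    have "\<bar>c * cos a\<bar> \<le> \<bar>c\<bar>" for a
      by (simp add: abs_mult mult_left_le)
    then show ?case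
      by (intro conv1[of "\<lambda>a. c * cos (a + d)" "\<bar>c\<bar>" t] continuous_intros)
  next
    case (add g h)
    then show ?case
      using trig_int[of g] trig_int[of h] by (simp add: tendsto_add)
  qed
  \<comment> \<open>A continuous majorant of the indicator of the complement of the cube of radius \<open>k + 1\<close>.\<close>
  define H where "H k x = (\<Sum>i<N. min 1 (max 0 (\<bar>x i\<bar> - k)))" for k :: real and x :: "nat \<Rightarrow> real"
  have H_int: "integrable M (\<lambda>\<omega>. H k (X n \<omega>))" "integrable L (\<lambda>\<omega>. H k (Y \<omega>))" for k n
    unfolding H_def by (auto intro!: Bochner_Integration.integrable_sum
        M.integrable_const_bound[where B = 1] L.integrable_const_bound[where B = 1])
  have conv_H: "(\<lambda>n. \<integral>\<omega>. H k (X n \<omega>) \<partial>M) \<longlonglongrightarrow> (\<integral>\<omega>. H k (Y \<omega>) \<partial>L)" for k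
  proof -
    have "(\<lambda>n. \<integral>\<omega>. min 1 (max 0 (\<bar>X n \<omega> i\<bar> - k)) \<partial>M) \<longlonglongrightarrow>
        (\<integral>\<omega>. min 1 (max 0 (\<bar>Y \<omega> i\<bar> - k)) \<partial>L)" if "i < N" for i
    proof -
      have "(\<Sum>j<N. (if j = i then 1 else 0) * x j) = x i" for x :: "nat \<Rightarrow> real"
        using that by (simp add: if_distrib if_distribR cong: if_cong)
      then show ?thesis
        using conv1[of "\<lambda>x. min 1 (max 0 (\<bar>x\<bar> - k))" 1 "\<lambda>j. if j = i then 1 else 0"]
        by (simp add: continuous_intros)
    qed
    then have "(\<lambda>n. \<Sum>i<N. \<integral>\<omega>. min 1 (max 0 (\<bar>X n \<omega> i\<bar> - k)) \<partial>M) \<longlonglongrightarrow>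
        (\<Sum>i<N. \<integral>\<omega>. min 1 (max 0 (\<bar>Y \<omega> i\<bar> - k)) \<partial>L)"
      by (intro tendsto_sum) simp
    moreover have "integrable M (\<lambda>\<omega>. min 1 (max 0 (\<bar>X n \<omega> i\<bar> - k)))"
      "integrable L (\<lambda>\<omega>. min 1 (max 0 (\<bar>Y \<omega> i\<bar> - k)))" for n i
      by (auto intro!: M.integrable_const_bound[where B = 1] L.integrable_const_bound[where B = 1])
    ultimately show ?thesis
      unfolding H_def by (simp add: Bochner_Integration.integral_sum)
  qed
  \<comment> \<open>Only the single limit variable has to be tight. Together with
    \<open>conv_H\<close> this makes the mass of \<open>X n\<close> outside the cube small for all
    large n.\<close>
  have tight: "(\<lambda>k. \<integral>\<omega>. H (real k) (Y \<omega>) \<partial>L) \<longlonglongrightarrow> (\<integral>\<omega>. 0 \<partial>L)"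
  proof (rule integral_dominated_convergence[where w = "\<lambda>_. real N"])
    show "AE \<omega> in L. (\<lambda>k. H (real k) (Y \<omega>)) \<longlonglongrightarrow> 0"
    proof (intro AE_I2)
      fix \<omega>
      have "(\<lambda>k. min 1 (max 0 (\<bar>Y \<omega> i\<bar> - real k))) \<longlonglongrightarrow> 0" for i
      proof (rule tendsto_eventually)
        obtain m :: nat where "\<bar>Y \<omega> i\<bar> \<le> real m" using real_arch_simple by blast
        then show "eventually (\<lambda>k. min 1 (max 0 (\<bar>Y \<omega> i\<bar> - real k)) = 0) sequentially"
          by (intro eventually_sequentiallyI[of m]) simp
      qed
      then show "(\<lambda>k. H (real k) (Y \<omega>)) \<longlonglongrightarrow> 0"
        unfolding H_def by (intro tendsto_null_sum) simp
    qed
    show "AE \<omega> in L. norm (H (real k) (Y \<omega>)) \<le> real N" for k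
    proof (intro AE_I2)
      fix \<omega>
      have "norm (H (real k) (Y \<omega>)) \<le> (\<Sum>i<N. 1)"
        unfolding H_def by (rule sum_norm_le) simp
      then show "norm (H (real k) (Y \<omega>)) \<le> real N" by simp
    qed
  qed (auto simp: H_def)
  obtain C where C: "\<And>x. \<bar>f x\<bar> \<le> C"
    using bdd unfolding bounded_iff by auto
  have "0 \<le> C" using C[of "\<lambda>_. 0"] by linarith
  have f_meas: "f \<in> borel_measurable borel"
    by (rule borel_measurable_continuous_onI[OF cont])
  have f_int: "integrable M (\<lambda>\<omega>. f (X n \<omega>))" "integrable L (\<lambda>\<omega>. f (Y \<omega>))" for n
  proof -
    have "X n \<in> borel_measurable M" "Y \<in> borel_measurable L"
      by (auto intro: measurable_coordinatewise_then_product)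
    with f_meas have [measurable]: "(\<lambda>\<omega>. f (X n \<omega>)) \<in> borel_measurable M"
      "(\<lambda>\<omega>. f (Y \<omega>)) \<in> borel_measurable L"
      by (auto intro: measurable_compose)
    show "integrable M (\<lambda>\<omega>. f (X n \<omega>))" "integrable L (\<lambda>\<omega>. f (Y \<omega>))"
      using C by (auto intro!: M.integrable_const_bound[where B = C] L.integrable_const_bound[where B = C])
  qed
  show ?thesis
  proof (rule tendstoI)
    fix e :: real
    assume "e > 0"
    \<comment> \<open>Error budget: each of the two replacements of \<open>f\<close> by
      \<open>g\<close> costs at most \<open>2 * C * \<delta> / 3 + e / 12\<close> and the
      convergence for \<open>g\<close> costs \<open>e / 12\<close>, in total at most
      \<open>7 * e / 12\<close>. Writing \<open>C + 1\<close> avoids a division by zero when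
      \<open>C\<close> is 0.\<close>
    define \<delta> where "\<delta> = e / (4 * (C + 1))"
    have \<delta>: "\<delta> > 0" "2 * C * \<delta> \<le> e / 2" 
      using \<open>e > 0\<close> \<open>0 \<le> C\<close> by (auto simp: \<delta>_def field_simps)
    have "eventually (\<lambda>k. (\<integral>\<omega>. H (real k) (Y \<omega>) \<partial>L) < \<delta> / 3) sequentially"
      using order_tendstoD(2)[OF tight, of "\<delta> / 3"] \<delta> by simp
    then obtain k :: nat where k: "(\<integral>\<omega>. H (real k) (Y \<omega>) \<partial>L) < \<delta> / 3"
      by (meson eventually_happens' sequentially_bot)
    define R where "R = real k + 1"
    have "R > 0" unfolding R_def by simp
    obtain g where g: "g \<in> trig_sums N"
      "\<And>x. \<bar>f (\<lambda>i. R * arcsin (sin (x i / R))) - g x\<bar> < e / 12"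
      using trig_sums_approx[OF cont coords _ \<open>R > 0\<close>, of N "e / 12"] \<open>e > 0\<close> by auto
    have H_nonneg: "0 \<le> H k x" for x
      unfolding H_def by (intro sum_nonneg) simp
    have approx: "\<bar>f x - g x\<bar> \<le> 2 * C * H k x + e / 12" for x
    proof (cases "\<forall>i<N. \<bar>x i\<bar> \<le> R")
      case True
      have "f x = f (\<lambda>i. R * arcsin (sin (x i / R)))"
      proof (rule coords)
        fix i assume "i < N"
        \<comment> \<open>On the cube the rescaled coordinates lie in [-1, 1], hence within
          \<open>pi / 2\<close> of 0, where arcsin inverts the sine.\<close>
        then have "\<bar>x i / R\<bar> \<le> 1" using True \<open>R > 0\<close> by (simp add: abs_divide)
        then have "arcsin (sin (x i / R)) = x i / R"
          using pi_ge_two by (intro arcsin_sin) linarith+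
        then show "x i = R * arcsin (sin (x i / R))" using \<open>R > 0\<close> by simp
      qed
      then show ?thesis
        using g(2)[of x] H_nonneg[of x] \<open>0 \<le> C\<close> 
        by (metis add_increasing less_imp_le mult_nonneg_nonneg zero_le_numeral)
    next
      case False
      then obtain i where "i < N" "\<bar>x i\<bar> > R" by auto
      then have "1 \<le> min 1 (max 0 (\<bar>x i\<bar> - real k))"
        unfolding R_def by simp
      also have "\<dots> \<le> H k x"
        unfolding H_def using \<open>i < N\<close> by (intro member_le_sum) auto
      finally have "2 * C * 1 \<le> 2 * C * H k x"
        using \<open>0 \<le> C\<close> by (intro mult_left_mono) auto
      \<comment> \<open>Although \<open>x\<close> lies outside the cube, \<open>g x\<close> is still
        within \<open>e / 12\<close> of some value of \<open>f\<close>, namely its value at the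
        folded point; so both function values are bounded in terms of \<open>C\<close>.\<close>
      then show ?thesis
        using C[of x] C[of "\<lambda>i. R * arcsin (sin (x i / R))"] g(2)[of x] by linarith
    qed
    have close_X: "\<bar>(\<integral>\<omega>. f (X n \<omega>) \<partial>M) - (\<integral>\<omega>. g (X n \<omega>) \<partial>M)\<bar>
        \<le> 2 * C * (\<integral>\<omega>. H k (X n \<omega>) \<partial>M) + e / 12" for n
    proof -
      note int = f_int(1)[of n] trig_int(1)[OF g(1), of n] H_int(1)[of k n]
      have "\<bar>\<integral>\<omega>. f (X n \<omega>) - g (X n \<omega>) \<partial>M\<bar> \<le> (\<integral>\<omega>. 2 * C * H k (X n \<omega>) + e / 12 \<partial>M)"
        by (intro order_trans[OF integral_abs_bound] integral_mono approx) (use int in auto)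
      then show ?thesis using int by (simp add: M.prob_space L.prob_space)
    qed
    have close_Y: "\<bar>(\<integral>\<omega>. f (Y \<omega>) \<partial>L) - (\<integral>\<omega>. g (Y \<omega>) \<partial>L)\<bar>
        \<le> 2 * C * (\<integral>\<omega>. H k (Y \<omega>) \<partial>L) + e / 12"
    proof -
      note int = f_int(2) trig_int(2)[OF g(1)] H_int(2)[of k]
      have "\<bar>\<integral>\<omega>. f (Y \<omega>) - g (Y \<omega>) \<partial>L\<bar> \<le> (\<integral>\<omega>. 2 * C * H k (Y \<omega>) + e / 12 \<partial>L)"
        by (intro order_trans[OF integral_abs_bound] integral_mono approx) (use int in auto)
      then show ?thesis using int by (simp add: M.prob_space L.prob_space)
    qed
    have ev: "eventually (\<lambda>n. (\<integral>\<omega>. H k (X n \<omega>) \<partial>M) < \<delta> / 3) sequentially"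
      using order_tendstoD(2)[OF conv_H k] .
    have ev': "eventually (\<lambda>n. dist (\<integral>\<omega>. g (X n \<omega>) \<partial>M) (\<integral>\<omega>. g (Y \<omega>) \<partial>L) < e / 12) sequentially"
      by (rule tendstoD[OF conv_trig[OF g(1)]]) (use \<open>e > 0\<close> in simp)
    show "eventually (\<lambda>n. dist (\<integral>\<omega>. f (X n \<omega>) \<partial>M) (\<integral>\<omega>. f (Y \<omega>) \<partial>L) < e) sequentially"
      using ev ev'
    proof eventually_elim
      case (elim n)
      have "2 * C * (\<integral>\<omega>. H k (X n \<omega>) \<partial>M) \<le> 2 * C * (\<delta> / 3)"
        "2 * C * (\<integral>\<omega>. H k (Y \<omega>) \<partial>L) \<le> 2 * C * (\<delta> / 3)"
        using elim(1) k \<open>0 \<le> C\<close> by (intro mult_left_mono; linarith)+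
      then show ?case
        using elim(2) close_X[of n] close_Y \<delta>(2) \<open>e > 0\<close> unfolding dist_real_def by linarith
    qed
  qed
qed

subsection \<open>Sylvester matrices\<close>

lemma sylvester_carrier [simp, intro]: "sylvester p \<in> carrier_mat (2 ^ p) (2 ^ p)"
  by (induction p) (auto simp: mult_2)

lemma dim_sylvester [simp]: "dim_row (sylvester p) = 2 ^ p" "dim_col (sylvester p) = 2 ^ p"
  using sylvester_carrier[of p] by (simp_all only: carrier_matD)

lemma transpose_sylvester [simp]: "transpose_mat (sylvester p) = sylvester p"
proof (induction p)
  case (Suc p)
  then show ?case
    using transpose_four_block_mat[of "sylvester p" "2 ^ p" "2 ^ p" "sylvester p" "2 ^ p" "sylvester p" "2 ^ p" "- sylvester p"]
    by (simp add: transpose_uminus)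
qed simp

lemma sylvester_entry_square:
  assumes "i < 2 ^ p" "j < 2 ^ p"
  shows "(sylvester p $$ (i, j))\<^sup>2 = 1"
  using assms
proof (induction p arbitrary: i j)
  case (Suc p)
  have "i - 2 ^ p < 2 ^ p" "j - 2 ^ p < 2 ^ p"
    using Suc.prems by auto
  then show ?case
    using Suc by auto
qed simp

lemma sylvester_square: "sylvester p * sylvester p = 2 ^ p \<cdot>\<^sub>m 1\<^sub>m (2 ^ p)"
proof (induction p)
  case (Suc p)
  let ?H = "sylvester p" and ?N = "2 ^ p :: nat"
  have "sylvester (Suc p) * sylvester (Suc p) =
      four_block_mat (?H * ?H + ?H * ?H) (?H * ?H + ?H * (- ?H))
        (?H * ?H + (- ?H) * ?H) (?H * ?H + (- ?H) * (- ?H))"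
    unfolding sylvester.simps
    by (rule mult_four_block_mat[where ?nr1.0 = ?N and ?n1.0 = ?N and ?n2.0 = ?N and ?nr2.0 = ?N
          and ?nc1.0 = ?N and ?nc2.0 = ?N]) auto
  also have "\<dots> = four_block_mat (?H * ?H + ?H * ?H) (?H * ?H + - (?H * ?H))
        (?H * ?H + - (?H * ?H)) (?H * ?H + ?H * ?H)"
  proof -
    have "?H * (- ?H) = - (?H * ?H)" "(- ?H) * ?H = - (?H * ?H)" "(- ?H) * (- ?H) = ?H * ?H"
      by (rule eq_matI; simp)+
    then show ?thesis by simp
  qed
  also have "\<dots> = 2 ^ Suc p \<cdot>\<^sub>m 1\<^sub>m (2 ^ Suc p)"
    unfolding Suc.IH by (rule eq_matI) auto
  finally show ?case .
qed (auto intro: eq_matI)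

lemma scalar_prod_row_sylvester:
  assumes "i < 2 ^ p" "j < 2 ^ p"
  shows "row (sylvester p) i \<bullet> row (sylvester p) j = (if i = j then 2 ^ p else 0)"
proof -
  have "(sylvester p * transpose_mat (sylvester p)) $$ (i, j) = row (sylvester p) i \<bullet> row (sylvester p) j"
    using assms by (subst index_mult_mat) (auto simp del: transpose_sylvester)
  then show ?thesis
    using assms by (auto simp: sylvester_square split: if_splits)
qed

lemma row_sylvester_eq_iff:
  assumes "i < 2 ^ p" "j < 2 ^ p"
  shows "row (sylvester p) i = row (sylvester p) j \<longleftrightarrow> i = j"
  using scalar_prod_row_sylvester[OF assms] scalar_prod_row_sylvester[OF assms(1,1)]
  by (auto split: if_splits)

lemma row_sylvester_carrier [simp, intro]: "row (sylvester p) j \<in> carrier_vec (2 ^ p)"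
  by (rule carrier_vecI) simp

text \<open>The matrix is symmetric with square \<open>2 ^ p\<close> times the identity, so it can
  be moved across the scalar product. With a unit vector for \<open>x\<close> this is the inversion
  formula; with a general vector it expands a linear functional along the rows.\<close>

lemma sylvester_Parseval:
  assumes "x \<in> carrier_vec (2 ^ p)" "y \<in> carrier_vec (2 ^ p)"
  shows "(\<Sum>j<2 ^ p. (row (sylvester p) j \<bullet> x) * (row (sylvester p) j \<bullet> y)) = 2 ^ p * (x \<bullet> y)"
proof -
  let ?H = "sylvester p"
  have "(\<Sum>j<2 ^ p. (row ?H j \<bullet> x) * (row ?H j \<bullet> y)) = (?H *\<^sub>v x) \<bullet> (?H *\<^sub>v y)"
    by (simp add: scalar_prod_def[of _ "?H *\<^sub>v y"] lessThan_atLeast0)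
  also have "\<dots> = x \<bullet> (?H *\<^sub>v (?H *\<^sub>v y))"
  proof -
    have carrier: "?H *\<^sub>v z \<in> carrier_vec (2 ^ p)" if "z \<in> carrier_vec (2 ^ p)" for z
      using that by (rule mult_mat_vec_carrier[OF sylvester_carrier])
    have "(?H *\<^sub>v x) \<bullet> (?H *\<^sub>v y) = (?H *\<^sub>v y) \<bullet> (?H *\<^sub>v x)"
      by (intro comm_scalar_prod[of _ "2 ^ p"] carrier assms)
    also have "\<dots> = (?H *\<^sub>v (?H *\<^sub>v y)) \<bullet> x"
      using transpose_vec_mult_scalar[OF sylvester_carrier assms(1) carrier[OF assms(2)]] by simp
    also have "\<dots> = x \<bullet> (?H *\<^sub>v (?H *\<^sub>v y))"
      by (intro comm_scalar_prod[of _ "2 ^ p"] carrier assms)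
    finally show ?thesis .
  qed
  also have "?H *\<^sub>v (?H *\<^sub>v y) = 2 ^ p \<cdot>\<^sub>v y"
  proof -
    have "?H *\<^sub>v (?H *\<^sub>v y) = (2 ^ p \<cdot>\<^sub>m 1\<^sub>m (2 ^ p)) *\<^sub>v y"
      using assoc_mult_mat_vec[OF sylvester_carrier sylvester_carrier assms(2)]
      by (simp add: sylvester_square)
    also have "\<dots> = 2 ^ p \<cdot>\<^sub>v y"
      using assms by (intro eq_vecI) auto
    finally show ?thesis .
  qed
  finally show ?thesis using assms by simp
qed

text \<open>The rows span the whole space: Parseval with a unit vector recovers each entry from the
  products with the rows.\<close>

lemma sylvester_vec_eqI:
  assumes "x \<in> carrier_vec (2 ^ p)" "y \<in> carrier_vec (2 ^ p)"
    and "\<And>j. j < 2 ^ p \<Longrightarrow> row (sylvester p) j \<bullet> x = row (sylvester p) j \<bullet> y"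
  shows "x = y"
proof (rule eq_vecI)
  fix k assume "k < dim_vec y"
  then have k: "k < 2 ^ p" using assms by simp
  have "2 ^ p * (unit_vec (2 ^ p) k \<bullet> x) = 2 ^ p * (unit_vec (2 ^ p) k \<bullet> y)"
    using assms(1,2) assms(3) by (simp flip: sylvester_Parseval del: scalar_prod_left_unit)
  then show "x $ k = y $ k"
    using assms(1,2) k by simp
qed (use assms in auto)

text \<open>Induction over the entries. The leading factor (1, x) appends to a row \<open>v\<close>
  of the smaller matrix the vector x times \<open>v\<close>. For x = 1 this is the row with the same
  index in the upper half of the block matrix, for x = -1 the corresponding row of the lower
  half.\<close>

lemma tensor_vec_in_rows:
  assumes "a \<in> sign_vecs p"
  shows "tensor_vec a \<in> set (rows (sylvester p))"
proof -
  have "\<exists>j<2 ^ length xs. foldr (\<lambda>x v. kron_vec (vec_of_list [1, x]) v) xs (vec_of_list [1])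
      = row (sylvester (length xs)) j" if "set xs \<subseteq> {-1, 1}" for xs :: "real list"
    using that
  proof (induction xs)
    case Nil
    show ?case by (auto intro!: eq_vecI)
  next
    case (Cons x xs)
    let ?H = "sylvester (length xs)" and ?N = "2 ^ length xs :: nat"
    obtain j where j: "j < ?N"
      "foldr (\<lambda>x v. kron_vec (vec_of_list [1, x]) v) xs (vec_of_list [1]) = row ?H j"
      using Cons by auto
    have uminus_eq_smult: "- v = (-1) \<cdot>\<^sub>v v" for v :: "real vec"
      by (rule eq_vecI) auto
    have kron: "kron_vec (vec_of_list [1, x]) (row ?H j) = row ?H j @\<^sub>v (x \<cdot>\<^sub>v row ?H j)"
    proof (rule eq_vecI)
      fix k assume "k < dim_vec (row ?H j @\<^sub>v (x \<cdot>\<^sub>v row ?H j))"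
      then have k: "k < ?N + ?N" by simp
      show "kron_vec (vec_of_list [1, x]) (row ?H j) $ k = (row ?H j @\<^sub>v (x \<cdot>\<^sub>v row ?H j)) $ k"
      proof (cases "k < ?N")
        case False
        then have "k div ?N = 1" "k mod ?N = k - ?N"
          using k by (auto simp: div_nat_eqI mod_if)
        then show ?thesis
          using False k by (simp add: kron_vec_def)
      qed (use k in \<open>simp add: kron_vec_def\<close>)
    qed (simp add: kron_vec_def)
    note rows = row_four_block_mat[of ?H ?N ?N ?H ?N ?H ?N "- ?H"]
    have "x = 1 \<or> x = -1" using Cons.prems by auto
    then show ?case
    proof
      assume "x = 1"
      then have "kron_vec (vec_of_list [1, x]) (row ?H j) = row (sylvester (Suc (length xs))) j"
        using rows(1)[of j] j(1) kron by simp
      then show ?thesis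
        using j by (intro exI[of _ j]) simp
    next
      assume "x = -1"
      then have "kron_vec (vec_of_list [1, x]) (row ?H j) = row (sylvester (Suc (length xs))) (?N + j)"
        using rows(2)[of "?N + j"] j(1) kron \<open>x = -1\<close>
        by (simp add: uminus_eq_smult)
      then show ?thesis
        using j by (intro exI[of _ "?N + j"]) simp
    qed
  qed
  moreover have "set (list_of_vec a) \<subseteq> {-1, 1}" "length (list_of_vec a) = p"
    using assms unfolding sign_vecs_def by (auto simp: set_list_of_vec vec_set_def)
  ultimately obtain j where "j < 2 ^ p" "tensor_vec a = row (sylvester p) j"
    unfolding tensor_vec_def by metis
  then show ?thesis
    unfolding rows_def by simp
qed

section \<open>Coordinates, limiting covariance and Gaussian vector in terms of the rows\<close>

lemma index_eq_sylvester_sum: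
  assumes "x \<in> carrier_vec (2 ^ p)" "k < 2 ^ p"
  shows "x $ k = (\<Sum>j<2 ^ p. row (sylvester p) j $ k * (row (sylvester p) j \<bullet> x)) / 2 ^ p"
proof -
  have "(\<Sum>j<2 ^ p. (row (sylvester p) j \<bullet> unit_vec (2 ^ p) k) * (row (sylvester p) j \<bullet> x)) = 2 ^ p * (unit_vec (2 ^ p) k \<bullet> x)"
    by (rule sylvester_Parseval) (use assms in auto)
  then show ?thesis
    using assms by simp
qed

text \<open>With \<open>y\<close> the image of \<open>t\<close> under the symmetric Sylvester
  matrix, the form is the diagonal one at \<open>y\<close>, and \<open>2 ^ (2 * p)\<close> is the
  square of \<open>2 ^ p\<close>. The weighted sum of squares is the shape in which both the cell
  residuals and the Gaussian vector deliver their variances.\<close>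

lemma sylvester_diag_quadratic_form:
  assumes t: "t \<in> carrier_vec (2 ^ p)"
  shows "t \<bullet> (((1 / 2 ^ (2 * p)) \<cdot>\<^sub>m (sylvester p * mat_diag (2 ^ p) d * sylvester p)) *\<^sub>v t) =
    (\<Sum>j<2 ^ p. ((row (sylvester p) j \<bullet> t) / 2 ^ p)\<^sup>2 * d j)"
proof -
  let ?H = "sylvester p" and ?D = "mat_diag (2 ^ p) d"
  define y where "y = ?H *\<^sub>v t"
  have y: "y \<in> carrier_vec (2 ^ p)"
    unfolding y_def by (rule mult_mat_vec_carrier[OF sylvester_carrier t])
  have Dy: "?D *\<^sub>v y \<in> carrier_vec (2 ^ p)"
    by (rule mult_mat_vec_carrier[OF mat_diag_dim y])
  have HDy: "?H *\<^sub>v (?D *\<^sub>v y) \<in> carrier_vec (2 ^ p)"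
    by (rule mult_mat_vec_carrier[OF sylvester_carrier Dy])
  have HD: "?H * ?D \<in> carrier_mat (2 ^ p) (2 ^ p)"
    by (rule mult_carrier_mat[OF sylvester_carrier mat_diag_dim])
  have "((1 / 2 ^ (2 * p)) \<cdot>\<^sub>m (?H * ?D * ?H)) *\<^sub>v t = (1 / 2 ^ (2 * p)) \<cdot>\<^sub>v ((?H * ?D * ?H) *\<^sub>v t)"
    using t HD by (intro eq_vecI) auto
  also have "(?H * ?D * ?H) *\<^sub>v t = (?H * ?D) *\<^sub>v y"
    unfolding y_def by (rule assoc_mult_mat_vec[OF HD sylvester_carrier t])
  also have "\<dots> = ?H *\<^sub>v (?D *\<^sub>v y)"
    by (rule assoc_mult_mat_vec[OF sylvester_carrier mat_diag_dim y])
  finally have "t \<bullet> (((1 / 2 ^ (2 * p)) \<cdot>\<^sub>m (?H * ?D * ?H)) *\<^sub>v t) = (1 / 2 ^ (2 * p)) * (t \<bullet> (?H *\<^sub>v (?D *\<^sub>v y)))"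
    using t HDy by simp
  also have "t \<bullet> (?H *\<^sub>v (?D *\<^sub>v y)) = (?H *\<^sub>v (?D *\<^sub>v y)) \<bullet> t"
    by (rule comm_scalar_prod[OF t HDy])
  also have "\<dots> = (?D *\<^sub>v y) \<bullet> y"
    using transpose_vec_mult_scalar[OF sylvester_carrier t Dy] by (simp add: y_def)
  also have "\<dots> = (\<Sum>j<2 ^ p. (?D *\<^sub>v y) $ j * y $ j)"
    unfolding scalar_prod_def carrier_vecD[OF y] by (simp add: lessThan_atLeast0)
  also have "\<dots> = (\<Sum>j<2 ^ p. (row ?H j \<bullet> t)\<^sup>2 * d j)"
  proof (rule sum.cong)
    fix j assume "j \<in> {..<(2 :: nat) ^ p}"
    then have j: "j < 2 ^ p" by simp
    have "(?D *\<^sub>v y) $ j = row ?D j \<bullet> y"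
      using j by (simp add: mat_diag_def)
    also have "\<dots> = (\<Sum>i<2 ^ p. if i = j then d j * y $ j else 0)"
      unfolding scalar_prod_def carrier_vecD[OF y] lessThan_atLeast0
      by (intro sum.cong) (use j in \<open>auto simp: mat_diag_def\<close>)
    also have "\<dots> = d j * y $ j"
      using j by simp
    finally show "(?D *\<^sub>v y) $ j * y $ j = (row ?H j \<bullet> t)\<^sup>2 * d j"
      using j by (simp add: y_def power2_eq_square)
  qed simp
  finally show ?thesis
    by (simp add: sum_distrib_left power_divide power_mult mult.commute[of 2 p] sum_divide_distrib)
qed

text \<open>All entries of the Sylvester matrix are 1 or -1, so each diagonal entry of the product
  weights every \<open>d j\<close> with a square equal to 1.\<close>

lemma sylvester_diag_diagonal:
  assumes i: "i < 2 ^ p"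
  shows "((1 / 2 ^ (2 * p)) \<cdot>\<^sub>m (sylvester p * mat_diag (2 ^ p) d * sylvester p)) $$ (i, i) =
    mat_trace (mat_diag (2 ^ p) d) / 2 ^ (2 * p)"
proof -
  let ?H = "sylvester p" and ?D = "mat_diag (2 ^ p) d"
  have HD: "?H * ?D = Matrix.mat (2 ^ p) (2 ^ p) (\<lambda>(i, j). ?H $$ (i, j) * d j)"
    by (rule mat_diag_mult_right[OF sylvester_carrier])
  have "(?H * ?D * ?H) $$ (i, i) = row (?H * ?D) i \<bullet> col ?H i"
    using i unfolding HD by simp
  also have "\<dots> = (\<Sum>j<2 ^ p. (?H * ?D) $$ (i, j) * ?H $$ (j, i))"
    unfolding scalar_prod_def lessThan_atLeast0 using i unfolding HD by simp
  also have "\<dots> = (\<Sum>j<2 ^ p. d j)"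
  proof (rule sum.cong)
    fix j assume "j \<in> {..<(2 :: nat) ^ p}"
    then have j: "j < 2 ^ p" by simp
    have "?H $$ (j, i) = ?H $$ (i, j)"
      using i j index_transpose_mat(1)[of i ?H j] by simp
    then have "(?H * ?D) $$ (i, j) * ?H $$ (j, i) = (?H $$ (i, j))\<^sup>2 * d j"
      using i j unfolding HD by (simp add: power2_eq_square)
    then show "(?H * ?D) $$ (i, j) * ?H $$ (j, i) = d j"
      using sylvester_entry_square[OF i j] by simp
  qed simp
  also have "\<dots> = mat_trace ?D"
    unfolding mat_trace_def diag_mat_def mat_diag_def
    by (simp add: interv_sum_list_conv_sum_set_nat lessThan_atLeast0)
  finally show ?thesis
    using i unfolding HD by simp
qed

text \<open>Entry \<open>k\<close> of \<open>H * diag (sqrt d) * x / 2 ^ p\<close> with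
  \<open>H\<close> the Sylvester matrix; for standard normal \<open>x\<close> its covariance is
  \<open>H * diag d * H / 2 ^ (2 * p)\<close>. It is extended by 0 because
  \<open>Cramer_Wold\<close> works with all coordinates of a sequence.\<close>

definition sylvester_gaussian :: "nat \<Rightarrow> (nat \<Rightarrow> real) \<Rightarrow> (nat \<Rightarrow> real) \<Rightarrow> nat \<Rightarrow> real" where
  "sylvester_gaussian p d x k =
     (if k < 2 ^ p then \<Sum>j<2 ^ p. row (sylvester p) j $ k / 2 ^ p * sqrt (d j) * x j else 0)"

lemma sylvester_gaussian_measurable [measurable]:
  "(\<lambda>x. sylvester_gaussian p d x k) \<in> borel_measurable (\<Pi>\<^sub>M j\<in>{..<2 ^ p}. std_normal_distribution)"
proof (cases "k < 2 ^ p")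
  case True
  have "(\<lambda>x. x j) \<in> borel_measurable (\<Pi>\<^sub>M j\<in>{..<2 ^ p}. std_normal_distribution)" if "j < 2 ^ p" for j :: nat
    using measurable_component_singleton[of j "{..<2 ^ p}" "\<lambda>_. std_normal_distribution"] that by simp
  then show ?thesis
    unfolding sylvester_gaussian_def using True
    by simp
qed (simp add: sylvester_gaussian_def)

text \<open>Exchanging the two sums exhibits the functional as a linear combination of the
  independent coordinates \<open>x j\<close>. Nonnegativity of \<open>d\<close> lets the squared
  roots return \<open>d j\<close>.\<close>

lemma distr_sylvester_gaussian:
  assumes d: "\<And>j. j < 2 ^ p \<Longrightarrow> 0 \<le> d j"
  shows "distr (\<Pi>\<^sub>M j\<in>{..<2 ^ p}. std_normal_distribution) borel (\<lambda>x. \<Sum>k<2 ^ p. t k * sylvester_gaussian p d x k) =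
    normal_law 0 (\<Sum>j<2 ^ p. ((row (sylvester p) j \<bullet> vec (2 ^ p) t) / 2 ^ p)\<^sup>2 * d j)"
proof -
  define u where "u j = (row (sylvester p) j \<bullet> vec (2 ^ p) t) / 2 ^ p" for j
  have "(\<Sum>k<2 ^ p. t k * sylvester_gaussian p d x k) = (\<Sum>j<2 ^ p. u j * sqrt (d j) * x j)" for x
  proof -
    have "(\<Sum>k<2 ^ p. t k * sylvester_gaussian p d x k) =
        (\<Sum>k<2 ^ p. \<Sum>j<2 ^ p. row (sylvester p) j $ k * t k / 2 ^ p * (sqrt (d j) * x j))"
      by (intro sum.cong) (simp_all add: sylvester_gaussian_def sum_distrib_left mult_ac)
    also have "\<dots> = (\<Sum>j<2 ^ p. (\<Sum>k<2 ^ p. row (sylvester p) j $ k * t k / 2 ^ p) * (sqrt (d j) * x j))"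
      unfolding sum_distrib_right by (rule sum.swap)
    finally show ?thesis
      by (simp add: u_def scalar_prod_def lessThan_atLeast0 sum_divide_distrib mult_ac)
  qed
  then have "distr (\<Pi>\<^sub>M j\<in>{..<2 ^ p}. std_normal_distribution) borel (\<lambda>x. \<Sum>k<2 ^ p. t k * sylvester_gaussian p d x k) =
      normal_law 0 (\<Sum>j<2 ^ p. (u j * sqrt (d j))\<^sup>2)"
    by (simp only: distr_std_normal_linear_combination[OF finite_lessThan])
  also have "(\<Sum>j<2 ^ p. (u j * sqrt (d j))\<^sup>2) = (\<Sum>j<2 ^ p. (u j)\<^sup>2 * d j)"
    by (intro sum.cong) (simp_all add: power_mult_distrib d)
  finally show ?thesis unfolding u_def .
qed

subsection \<open>Least squares\<close>

definition cell_count :: "nat \<Rightarrow> nat \<Rightarrow> (nat \<Rightarrow> real vec) \<Rightarrow> nat \<Rightarrow> real" where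
  "cell_count p n a j = (\<Sum>i<n. of_bool (tensor_vec (a i) = row (sylvester p) j))"

definition cell_sum :: "nat \<Rightarrow> nat \<Rightarrow> (nat \<Rightarrow> real) \<Rightarrow> (nat \<Rightarrow> real vec) \<Rightarrow> nat \<Rightarrow> real" where
  "cell_sum p n r a j = (\<Sum>i<n. of_bool (tensor_vec (a i) = row (sylvester p) j) * r i)"

lemma set_rows_sylvester: "set (rows (sylvester p)) = row (sylvester p) ` {..<2 ^ p}"
  by (simp add: rows_def lessThan_atLeast0)

lemma tensor_vecE:
  assumes "a \<in> sign_vecs p"
  obtains j where "j < 2 ^ p" "tensor_vec a = row (sylvester p) j"
  using tensor_vec_in_rows[OF assms] by (auto simp: set_rows_sylvester)

lemma tensor_vec_carrier: "a \<in> sign_vecs p \<Longrightarrow> tensor_vec a \<in> carrier_vec (2 ^ p)"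
  by (erule tensor_vecE) simp

text \<open>Orthogonality turns the product with a row into a cell indicator; this is the bridge
  from linear algebra to counting.\<close>

lemma row_scalar_tensor:
  assumes "a \<in> sign_vecs p" "j < 2 ^ p"
  shows "row (sylvester p) j \<bullet> tensor_vec a = 2 ^ p * of_bool (tensor_vec a = row (sylvester p) j)"
proof -
  obtain k where "k < 2 ^ p" "tensor_vec a = row (sylvester p) k"
    using assms(1) by (rule tensor_vecE)
  then show ?thesis
    using assms(2) by (auto simp: scalar_prod_row_sylvester row_sylvester_eq_iff)
qed

lemma design_matrix_carrier: "design_matrix p n a \<in> carrier_mat n (2 ^ p)"
  unfolding design_matrix_def by (rule carrier_matI) simp_all

lemma gram_matrix_carrier: "gram_matrix p n a \<in> carrier_mat (2 ^ p) (2 ^ p)"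
  unfolding gram_matrix_def
  by (rule mult_carrier_mat[of _ _ n]) (simp_all add: design_matrix_carrier)

lemma row_design_matrix:
  assumes "i < n" "a i \<in> sign_vecs p"
  shows "row (design_matrix p n a) i = tensor_vec (a i)"
  using assms unfolding design_matrix_def by (subst mat_of_rows_row) (auto intro: tensor_vec_carrier)

lemma row_transpose_design_mult:
  assumes a: "\<forall>i<n. a i \<in> sign_vecs p" and y: "y \<in> carrier_vec n" and j: "j < 2 ^ p"
  shows "row (sylvester p) j \<bullet> (transpose_mat (design_matrix p n a) *\<^sub>v y) =
    2 ^ p * (\<Sum>i<n. of_bool (tensor_vec (a i) = row (sylvester p) j) * y $ i)"
proof -
  let ?X = "design_matrix p n a" and ?v = "row (sylvester p) j"
  note X = design_matrix_carrier[of p n a]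
  have Xy: "transpose_mat ?X *\<^sub>v y \<in> carrier_vec (2 ^ p)"
    by (rule mult_mat_vec_carrier[OF _ y]) (simp add: X)
  have "?v \<bullet> (transpose_mat ?X *\<^sub>v y) = y \<bullet> (?X *\<^sub>v ?v)"
    using transpose_vec_mult_scalar[OF X row_sylvester_carrier y] comm_scalar_prod[OF row_sylvester_carrier Xy]
    by simp
  also have "\<dots> = (\<Sum>i<n. y $ i * (tensor_vec (a i) \<bullet> ?v))"
    using X a by (auto simp: scalar_prod_def[of y] row_design_matrix lessThan_atLeast0 intro!: sum.cong)
  also have "\<dots> = (\<Sum>i<n. y $ i * (2 ^ p * of_bool (tensor_vec (a i) = ?v)))"
    by (intro sum.cong refl, subst comm_scalar_prod[of _ "2 ^ p"])
      (use a j in \<open>auto simp: row_scalar_tensor intro: tensor_vec_carrier\<close>)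
  finally show ?thesis
    by (simp only: sum_distrib_left mult_ac)
qed

text \<open>In other words, the rows are eigenvectors of the Gram matrix, with eigenvalues
  \<open>2 ^ p\<close> times the cell counts.\<close>

lemma row_gram_mult:
  assumes a: "\<forall>i<n. a i \<in> sign_vecs p" and b: "b \<in> carrier_vec (2 ^ p)" and j: "j < 2 ^ p"
  shows "row (sylvester p) j \<bullet> (gram_matrix p n a *\<^sub>v b) =
    2 ^ p * (cell_count p n a j * (row (sylvester p) j \<bullet> b))"
proof -
  let ?X = "design_matrix p n a" and ?v = "row (sylvester p) j"
  note X = design_matrix_carrier[of p n a]
  have Xb: "?X *\<^sub>v b \<in> carrier_vec n"
    by (rule mult_mat_vec_carrier[OF X b])
  have "gram_matrix p n a *\<^sub>v b = transpose_mat ?X *\<^sub>v (?X *\<^sub>v b)"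
    unfolding gram_matrix_def using X b by (intro assoc_mult_mat_vec[of _ _ n]) auto
  then have "?v \<bullet> (gram_matrix p n a *\<^sub>v b) =
      2 ^ p * (\<Sum>i<n. of_bool (tensor_vec (a i) = ?v) * (?X *\<^sub>v b) $ i)"
    using row_transpose_design_mult[OF a Xb j] by simp
  also have "(\<Sum>i<n. of_bool (tensor_vec (a i) = ?v) * (?X *\<^sub>v b) $ i) =
      (\<Sum>i<n. of_bool (tensor_vec (a i) = ?v) * (?v \<bullet> b))"
    using X by (intro sum.cong) (auto simp: row_design_matrix a)
  finally show ?thesis
    unfolding cell_count_def sum_distrib_right .
qed

lemma cell_count_nonneg: "0 \<le> cell_count p n a j"
  unfolding cell_count_def by (rule sum_nonneg) simp

lemma invertible_matE:
  assumes "invertible_mat G" and G: "G \<in> carrier_mat m m"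
  obtains C where "C \<in> carrier_mat m m" "G * C = 1\<^sub>m m" "C * G = 1\<^sub>m m"
proof -
  obtain C where C: "G * C = 1\<^sub>m m" "C * G = 1\<^sub>m (dim_row C)"
    using assms unfolding invertible_mat_def inverts_mat_def by auto
  \<comment> \<open>The notion of invertibility does not prescribe the shape of \<open>C\<close>;
    comparing the column numbers of the two products with those of the identities determines
    it.\<close>
  have "dim_col (G * C) = m" "dim_col (C * G) = dim_row C"
    unfolding C by simp_all
  then have "C \<in> carrier_mat m m"
    using G by auto
  with C that show ?thesis by simp
qed

lemma invertible_gram_iff:
  assumes a: "\<forall>i<n. a i \<in> sign_vecs p"
  shows "invertible_mat (gram_matrix p n a) \<longleftrightarrow> (\<forall>j<2 ^ p. cell_count p n a j > 0)"
proof
  let ?G = "gram_matrix p n a" and ?v = "row (sylvester p)"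
  note G = gram_matrix_carrier[of p n a]
  have Gv: "?G *\<^sub>v b \<in> carrier_vec (2 ^ p)" if "b \<in> carrier_vec (2 ^ p)" for b
    using that by (rule mult_mat_vec_carrier[OF G])
  {
    assume "invertible_mat ?G"
    then obtain C where C: "C \<in> carrier_mat (2 ^ p) (2 ^ p)" "C * ?G = 1\<^sub>m (2 ^ p)"
      using G by (rule invertible_matE)
    show "\<forall>j<2 ^ p. cell_count p n a j > 0"
    proof (intro allI impI, rule ccontr)
      fix j assume j: "j < 2 ^ p" and "\<not> cell_count p n a j > 0"
      then have 0: "cell_count p n a j = 0"
        using cell_count_nonneg[of p n a j] by simp
      \<comment> \<open>An empty cell puts its own row into the kernel of the Gram matrix.\<close>
      have "?G *\<^sub>v ?v j = 0\<^sub>v (2 ^ p)"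
        by (rule sylvester_vec_eqI[OF Gv[OF row_sylvester_carrier] zero_carrier_vec])
          (use j 0 in \<open>auto simp: row_gram_mult a scalar_prod_row_sylvester\<close>)
      then have "C *\<^sub>v (?G *\<^sub>v ?v j) = 0\<^sub>v (2 ^ p)"
        using C by auto
      then have "?v j = 0\<^sub>v (2 ^ p)"
        using C by (simp flip: assoc_mult_mat_vec[OF C(1) G row_sylvester_carrier])
      with scalar_prod_row_sylvester[OF j j] show False by simp
    qed
  }
  assume pos: "\<forall>j<2 ^ p. cell_count p n a j > 0"
  \<comment> \<open>Conversely, with all counts positive a kernel vector is orthogonal to every row
    and therefore zero.\<close>
  have "b = 0\<^sub>v (2 ^ p)" if b: "b \<in> carrier_vec (2 ^ p)" and Gb: "?G *\<^sub>v b = 0\<^sub>v (2 ^ p)" for b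
  proof (rule sylvester_vec_eqI[OF b zero_carrier_vec])
    fix j :: nat assume j: "j < 2 ^ p"
    have "2 ^ p * (cell_count p n a j * (?v j \<bullet> b)) = 0"
      using row_gram_mult[OF a b j] Gb by simp
    then show "?v j \<bullet> b = ?v j \<bullet> 0\<^sub>v (2 ^ p)"
      using pos[rule_format, OF j] by (simp add: scalar_prod_right_zero[OF row_sylvester_carrier])
  qed
  then have "det ?G \<noteq> 0"
    by (auto simp: det_0_iff_vec_prod_zero[OF G])
  from det_non_zero_imp_unit[OF G this, of undefined] show "invertible_mat ?G"
    using G unfolding Units_def ring_mat_def invertible_mat_def inverts_mat_def
    by auto
qed

lemma row_least_squares:
  assumes a: "\<forall>i<n. a i \<in> sign_vecs p" and inv: "invertible_mat (gram_matrix p n a)"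
  shows "least_squares p n r a \<in> carrier_vec (2 ^ p)"
    and "j < 2 ^ p \<Longrightarrow> row (sylvester p) j \<bullet> least_squares p n r a = cell_sum p n r a j / cell_count p n a j"
proof -
  let ?G = "gram_matrix p n a" and ?y = "transpose_mat (design_matrix p n a) *\<^sub>v vec n r"
  note G = gram_matrix_carrier[of p n a]
  have y: "?y \<in> carrier_vec (2 ^ p)"
    by (rule mult_mat_vec_carrier[of _ _ n]) (simp_all add: design_matrix_carrier)
  obtain C where "C \<in> carrier_mat (2 ^ p) (2 ^ p)" "?G * C = 1\<^sub>m (2 ^ p)" "C * ?G = 1\<^sub>m (2 ^ p)"
    using inv G by (rule invertible_matE)
  \<comment> \<open>\<open>mat_inverse\<close> returns \<open>None\<close> only outside the unit
    group of the matrix ring; membership ensures that \<open>the\<close> is applied to a genuine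
    inverse.\<close>
  then have "?G \<in> Units (ring_mat TYPE(real) (2 ^ p) undefined)"
    unfolding Units_def ring_mat_def using G by auto
  then obtain D where D: "mat_inverse ?G = Some D"
    using mat_inverse(1)[OF G] by fastforce
  from mat_inverse(2)[OF G this] have D': "?G * D = 1\<^sub>m (2 ^ p)" "D \<in> carrier_mat (2 ^ p) (2 ^ p)"
    by auto
  have ls: "least_squares p n r a = D *\<^sub>v ?y"
    unfolding least_squares_def D by simp
  show carrier: "least_squares p n r a \<in> carrier_vec (2 ^ p)"
    unfolding ls by (rule mult_mat_vec_carrier[OF D'(2) y])
  assume j: "j < 2 ^ p"
  \<comment> \<open>The normal equations. Their product with row \<open>j\<close> involves the data
    of the cell of \<open>j\<close> alone.\<close>
  have "?G *\<^sub>v least_squares p n r a = ?y"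
    unfolding ls using D' y by (simp flip: assoc_mult_mat_vec[OF G D'(2) y])
  then have "2 ^ p * (cell_count p n a j * (row (sylvester p) j \<bullet> least_squares p n r a)) =
      2 ^ p * cell_sum p n r a j"
    using row_gram_mult[OF a carrier j] row_transpose_design_mult[OF a vec_carrier j, of r]
    unfolding cell_sum_def by simp
  moreover have "cell_count p n a j > 0"
    using invertible_gram_iff[of n a p] a inv j by simp
  ultimately show "row (sylvester p) j \<bullet> least_squares p n r a = cell_sum p n r a j / cell_count p n a j"
    by (simp add: field_simps)
qed

subsection \<open>Maximum likelihood\<close>

text \<open>Gibbs' inequality for an empirical law. The inequality is proved with
  \<open>exp\<close>, so that \<open>P\<close> may vanish at observed points; logarithms appear only
  in the equality case, once all ratios are known to be positive. Equality is propagated to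
  unobserved points as well, since the observed ones then exhaust the total mass 1.\<close>

lemma empirical_likelihood_le:
  fixes P :: "'b \<Rightarrow> real" and y :: "nat \<Rightarrow> 'b"
  assumes "finite \<Omega>" and y: "\<And>i. i < n \<Longrightarrow> y i \<in> \<Omega>"
    and nonneg: "\<And>z. z \<in> \<Omega> \<Longrightarrow> 0 \<le> P z" and total: "sum P \<Omega> = 1"
  defines "E \<equiv> \<lambda>z. real (card {i. i < n \<and> y i = z}) / real n"
  shows "(\<Prod>i<n. P (y i)) \<le> (\<Prod>i<n. E (y i))"
    and "n > 0 \<Longrightarrow> (\<Prod>i<n. P (y i)) = (\<Prod>i<n. E (y i)) \<Longrightarrow> z \<in> \<Omega> \<Longrightarrow> P z = E z"
proof -
  have E_pos: "E (y i) > 0" if "i < n" for i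
  proof -
    have "i \<in> {k. k < n \<and> y k = y i}" using that by simp
    then have "card {k. k < n \<and> y k = y i} > 0"
      by (intro card_gt_0_iff[THEN iffD2] conjI) auto
    then show ?thesis using that unfolding E_def by simp
  qed
  \<comment> \<open>The product of these ratios is at most \<open>exp (\<Sum> (x i - 1)) \<le> 1\<close>, with equality iff all of them are \<open>1\<close>.\<close>
  define x where "x i = P (y i) / E (y i)" for i
  have x_nonneg: "0 \<le> x i" if "i < n" for i
    unfolding x_def using nonneg[OF y[OF that]] E_pos[OF that] by simp
  \<comment> \<open>Summation over observations is regrouped by observed value: the value
    \<open>z\<close> occurs \<open>n * E z\<close> times.\<close>
  have by_value: "(\<Sum>i<n. g (y i)) = (\<Sum>z\<in>y ` {..<n}. real n * E z * g z)" for g :: "'b \<Rightarrow> real"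
  proof -
    have "(\<Sum>i<n. g (y i)) = (\<Sum>z\<in>y ` {..<n}. \<Sum>i\<in>{i. i < n \<and> y i = z}. g (y i))"
      using sum.image_gen[of "{..<n}" "\<lambda>i. g (y i)" y] by simp
    also have "\<dots> = (\<Sum>z\<in>y ` {..<n}. real n * E z * g z)"
      by (intro sum.cong) (auto simp: E_def)
    finally show ?thesis .
  qed
  have image: "y ` {..<n} \<subseteq> \<Omega>" using y by auto
  have "(\<Sum>i<n. x i) = (\<Sum>z\<in>y ` {..<n}. real n * E z * (P z / E z))"
    unfolding x_def by (rule by_value)
  also have "\<dots> = real n * (\<Sum>z\<in>y ` {..<n}. P z)"
    unfolding sum_distrib_left by (intro sum.cong) (use E_pos in force)+
  finally have sum_x: "(\<Sum>i<n. x i) = real n * (\<Sum>z\<in>y ` {..<n}. P z)" .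
  \<comment> \<open>The loss here is n times the mass that \<open>P\<close> puts on unobserved
    points.\<close>
  also have "\<dots> \<le> real n * sum P \<Omega>"
    using image nonneg \<open>finite \<Omega>\<close> by (intro mult_left_mono sum_mono2) auto
  finally have sum_x_le: "(\<Sum>i<n. x i) \<le> real n"
    by (simp add: total)
  have prod_eq: "(\<Prod>i<n. P (y i)) = (\<Prod>i<n. x i) * (\<Prod>i<n. E (y i))"
    unfolding prod.distrib[symmetric] x_def by (intro prod.cong) (use E_pos in force)+
  have prod_E_pos: "(\<Prod>i<n. E (y i)) > 0"
    by (rule prod_pos) (use E_pos in auto)
  have "(\<Prod>i<n. x i) \<le> (\<Prod>i<n. exp (x i - 1))"
  proof (rule prod_mono)
    fix i assume "i \<in> {..<n}"
    then show "0 \<le> x i \<and> x i \<le> exp (x i - 1)"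
      using x_nonneg[of i] exp_ge_add_one_self[of "x i - 1"] by simp
  qed
  also have "\<dots> = exp ((\<Sum>i<n. x i) - real n)"
    by (simp flip: exp_sum add: sum_subtractf)
  also have "\<dots> \<le> 1" using sum_x_le by simp
  finally have prod_x_le: "(\<Prod>i<n. x i) \<le> 1" .
  then show "(\<Prod>i<n. P (y i)) \<le> (\<Prod>i<n. E (y i))"
    unfolding prod_eq using prod_E_pos by (simp add: mult_le_cancel_right2)
  assume "n > 0" and eq: "(\<Prod>i<n. P (y i)) = (\<Prod>i<n. E (y i))" and z: "z \<in> \<Omega>"
  from eq prod_E_pos have prod_x: "(\<Prod>i<n. x i) = 1"
    unfolding prod_eq by (simp del: prod_zero_iff)
  then have "x i \<noteq> 0" if "i < n" for i
    using that by (metis finite_lessThan lessThan_iff prod_zero_iff zero_neq_one)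
  with x_nonneg have x_pos: "x i > 0" if "i < n" for i
    using that by (metis less_eq_real_def)
  \<comment> \<open>Each gap is nonnegative and vanishes only at ratio 1. Since the product of the
    ratios is 1, the gaps add up to the sum of the ratios minus n, which is at most 0.\<close>
  define gap where "gap i = x i - 1 - ln (x i)" for i
  have gap_nonneg: "0 \<le> gap i" if "i \<in> {..<n}" for i
    using ln_le_minus_one[of "x i"] x_pos[of i] that unfolding gap_def by simp
  have "ln (\<Prod>i<n. x i) = (\<Sum>i<n. ln (x i))"
  proof (rule ln_prod)
    fix i assume "i \<in> {..<n}"
    then show "x i \<noteq> 0" using x_pos[of i] by simp
  qed simp
  then have "(\<Sum>i<n. gap i) \<le> 0"
    using sum_x_le prod_x unfolding gap_def by (simp add: sum_subtractf)
  moreover have "0 \<le> (\<Sum>i<n. gap i)"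
    by (rule sum_nonneg) (rule gap_nonneg)
  ultimately have "(\<Sum>i<n. gap i) = 0" by simp
  then have "\<forall>i\<in>{..<n}. gap i = 0"
    using sum_nonneg_eq_0_iff[of "{..<n}" gap] gap_nonneg by simp
  then have x_1: "x i = 1" if "i < n" for i
    using ln_eq_minus_one[of "x i"] x_pos[of i] that unfolding gap_def by auto
  have on_image: "P w = E w" if w: "w \<in> y ` {..<n}" for w
  proof -
    from w obtain i where "i < n" "w = y i" by auto
    then show ?thesis using x_1[of i] E_pos[of i] by (simp add: x_def)
  qed
  have "(\<Sum>z\<in>y ` {..<n}. P z) = 1"
    using sum_x x_1 \<open>n > 0\<close> by simp
  then have off_sum: "(\<Sum>z\<in>\<Omega> - y ` {..<n}. P z) = 0"
    using sum.subset_diff[OF image \<open>finite \<Omega>\<close>, of P] total by simp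
  show "P z = E z"
  proof (cases "z \<in> y ` {..<n}")
    case True
    then show ?thesis by (rule on_image)
  next
    case False
    then have none: "{i. i < n \<and> y i = z} = {}" by auto
    have "E z = 0" unfolding E_def none by simp
    moreover have "P z = 0"
      using sum_nonneg_0[OF _ _ off_sum, of z] False z nonneg \<open>finite \<Omega>\<close> by simp
    ultimately show ?thesis by simp
  qed
qed

lemma linf_norm_le_iff:
  assumes "dim_vec v > 0"
  shows "linf_norm v \<le> c \<longleftrightarrow> (\<forall>i<dim_vec v. \<bar>v $ i\<bar> \<le> c)"
  unfolding linf_norm_def using assms by (subst Max_le_iff) auto

lemma linf_norm_sylvester_le_iff:
  "linf_norm (sylvester p *\<^sub>v b) \<le> c \<longleftrightarrow> (\<forall>j<2 ^ p. \<bar>row (sylvester p) j \<bullet> b\<bar> \<le> c)"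
  by (subst linf_norm_le_iff) auto

lemma card_eq_sum_of_bool:
  fixes n :: nat
  shows "real (card {i. i < n \<and> Q i}) = (\<Sum>i<n. of_bool (Q i))"
proof -
  have "{i. i < n \<and> Q i} = {i \<in> {..<n}. Q i}" by auto
  then have "real (card {i. i < n \<and> Q i}) = (\<Sum>i\<in>{i \<in> {..<n}. Q i}. 1)"
    by simp
  also have "\<dots> = (\<Sum>i<n. of_bool (Q i))"
    unfolding of_bool_def by (rule sum.inter_filter) simp
  finally show ?thesis .
qed

text \<open>The bound on \<open>linf_norm\<close> says exactly that both conditional probabilities
  at each row are nonnegative. The terms linear in \<open>b\<close> cancel when the two responses
  are summed, which leaves the total mass of \<open>q\<close>.\<close>

lemma joint_prob_model_params:
  assumes \<theta>: "\<theta> \<in> model_params p"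
  defines "P \<equiv> \<lambda>(\<rho>, u). fst \<theta> u * ((1 + \<rho> * (snd \<theta> \<bullet> u)) / 2)"
  shows "z \<in> {-1, 1} \<times> set (rows (sylvester p)) \<Longrightarrow> 0 \<le> P z"
    and "sum P ({-1, 1} \<times> set (rows (sylvester p))) = 1"
proof -
  let ?V = "set (rows (sylvester p))"
  obtain q b where \<theta>_eq: "\<theta> = (q, b)" by (cases \<theta>)
  from \<theta> have q: "\<And>u. u \<in> ?V \<Longrightarrow> 0 \<le> q u" "sum q ?V = 1" and b: "b \<in> carrier_vec (2 ^ p)"
    and linf: "\<And>j. j < 2 ^ p \<Longrightarrow> \<bar>row (sylvester p) j \<bullet> b\<bar> \<le> 1"
    unfolding model_params_def \<theta>_eq by (auto simp: linf_norm_sylvester_le_iff)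
  have bound: "\<bar>b \<bullet> u\<bar> \<le> 1" if u: "u \<in> ?V" for u
  proof -
    obtain j where j: "j < 2 ^ p" "u = row (sylvester p) j"
      using u by (auto simp: set_rows_sylvester)
    have "b \<bullet> u = u \<bullet> b"
      unfolding j by (rule comm_scalar_prod[OF b row_sylvester_carrier])
    then show ?thesis using linf[OF j(1)] j(2) by simp
  qed
  show "0 \<le> P z" if "z \<in> {-1, 1} \<times> ?V"
    using that bound[of "snd z"] q(1)[of "snd z"] unfolding P_def \<theta>_eq by (auto intro!: mult_nonneg_nonneg)
  have "sum P ({-1, 1} \<times> ?V) = (\<Sum>\<rho>\<in>{-1, 1}. \<Sum>u\<in>?V. P (\<rho>, u))"
    by (simp add: sum.cartesian_product)
  also have "\<dots> = (\<Sum>u\<in>?V. P (-1, u) + P (1, u))"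
    by (simp add: sum.distrib)
  also have "\<dots> = sum q ?V"
    by (intro sum.cong) (auto simp: P_def \<theta>_eq field_simps)
  finally show "sum P ({-1, 1} \<times> ?V) = 1" using q(2) by simp
qed

text \<open>The model is saturated: with cell frequencies \<open>qh\<close> and least squares vector
  \<open>bh\<close> it contains the empirical law itself. Gibbs' inequality determines the
  maximizing law; the vector is then recovered from it because invertibility gives every cell
  positive empirical mass.\<close>

theorem is_mle_iff_least_squares:
  assumes a: "\<forall>i<n. a i \<in> sign_vecs p" and r: "\<forall>i<n. r i \<in> {-1, 1}"
    and inv: "invertible_mat (gram_matrix p n a)"
  shows "is_mle p n r a b \<longleftrightarrow> b = least_squares p n r a"
proof -
  let ?V = "set (rows (sylvester p))" and ?v = "row (sylvester p)"
  define \<Omega> where "\<Omega> = {-1, 1 :: real} \<times> ?V"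
  define y where "y i = (r i, tensor_vec (a i))" for i
  define E where "E z = real (card {i. i < n \<and> y i = z}) / real n" for z
  define P where "P \<theta> z = fst \<theta> (snd z) * ((1 + fst z * (snd \<theta> \<bullet> snd z)) / 2)"
    for \<theta> :: "(real vec \<Rightarrow> real) \<times> real vec" and z
  define bh where "bh = least_squares p n r a"
  define qh where "qh u = real (card {i. i < n \<and> tensor_vec (a i) = u}) / real n" for u
  have pos: "cell_count p n a j > 0" if "j < 2 ^ p" for j
    using invertible_gram_iff[OF a] inv that by simp
  \<comment> \<open>An empty sample would leave cell 0 unoccupied.\<close>
  have "n > 0"
    using pos[of 0] unfolding cell_count_def by (cases n) auto
  have y: "y i \<in> \<Omega>" if "i < n" for i
    unfolding y_def \<Omega>_def using a r that tensor_vec_in_rows by auto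
  have "finite \<Omega>" unfolding \<Omega>_def by simp
  have likelihood: "likelihood n r a \<theta> = (\<Prod>i<n. P \<theta> (y i))" for \<theta>
    unfolding likelihood_def joint_prob_def P_def y_def by simp
  have P_model: "\<And>z. z \<in> \<Omega> \<Longrightarrow> 0 \<le> P \<theta> z" "sum (P \<theta>) \<Omega> = 1" if "\<theta> \<in> model_params p" for \<theta>
  proof -
    have "(\<lambda>(\<rho>, u). fst \<theta> u * ((1 + \<rho> * (snd \<theta> \<bullet> u)) / 2)) = P \<theta>"
      unfolding P_def by auto
    then show "\<And>z. z \<in> \<Omega> \<Longrightarrow> 0 \<le> P \<theta> z" "sum (P \<theta>) \<Omega> = 1"
      using joint_prob_model_params[OF that] unfolding \<Omega>_def by simp_all
  qed
  have bh: "bh \<in> carrier_vec (2 ^ p)"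
    "\<And>j. j < 2 ^ p \<Longrightarrow> ?v j \<bullet> bh = cell_sum p n r a j / cell_count p n a j"
    unfolding bh_def using row_least_squares[OF a inv] by simp_all
  have qh: "qh (?v j) = cell_count p n a j / real n" for j
    unfolding qh_def card_eq_sum_of_bool cell_count_def by simp
  have E_eq: "E z = P (qh, bh) z" if z_in: "z \<in> \<Omega>" for z
  proof -
    obtain \<rho> j where z: "z = (\<rho>, ?v j)" "\<rho> = -1 \<or> \<rho> = 1" "j < 2 ^ p"
      using z_in unfolding \<Omega>_def set_rows_sylvester by auto
    have "real (card {i. i < n \<and> y i = z}) = (\<Sum>i<n. of_bool (y i = z))"
      by (rule card_eq_sum_of_bool)
    \<comment> \<open>For two signs, the indicator of \<open>r i = \<rho>\<close> is
      \<open>(1 + \<rho> * r i) / 2\<close>, the same affine expression as in the model.\<close>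
    also have "\<dots> = (\<Sum>i<n. (of_bool (tensor_vec (a i) = ?v j) + \<rho> * (of_bool (tensor_vec (a i) = ?v j) * r i)) / 2)"
      by (intro sum.cong) (use r z in \<open>auto simp: y_def\<close>)
    also have "\<dots> = (cell_count p n a j + \<rho> * cell_sum p n r a j) / 2"
      unfolding cell_count_def cell_sum_def
      by (simp only: sum.distrib sum_distrib_left flip: sum_divide_distrib)
    finally have count: "real (card {i. i < n \<and> y i = z}) = (cell_count p n a j + \<rho> * cell_sum p n r a j) / 2" .
    moreover have "bh \<bullet> ?v j = cell_sum p n r a j / cell_count p n a j"
      using bh z(3) comm_scalar_prod[OF bh(1) row_sylvester_carrier] by simp
    ultimately show ?thesis
      using pos[OF z(3)] \<open>n > 0\<close> unfolding E_def count P_def z(1) by (simp add: qh field_simps)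
  qed
  have model: "(qh, bh) \<in> model_params p"
  proof -
    have "(\<Sum>u\<in>?V. qh u) = (\<Sum>u\<in>?V. \<Sum>i<n. of_bool (tensor_vec (a i) = u)) / real n"
      unfolding qh_def card_eq_sum_of_bool sum_divide_distrib ..
    also have "(\<Sum>u\<in>?V. \<Sum>i<n. of_bool (tensor_vec (a i) = u)) = (\<Sum>i<n. \<Sum>u\<in>?V. of_bool (tensor_vec (a i) = u))"
      by (rule sum.swap)
    also have "\<dots> = (\<Sum>i<n. 1 :: real)"
    proof (rule sum.cong)
      fix i assume "i \<in> {..<n}"
      then have "tensor_vec (a i) \<in> ?V" using a tensor_vec_in_rows by simp
      then show "(\<Sum>u\<in>?V. of_bool (tensor_vec (a i) = u)) = (1 :: real)"
        by (simp add: of_bool_def)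
    qed simp
    finally have "(\<Sum>u\<in>?V. qh u) = 1" using \<open>n > 0\<close> by simp
    moreover have "\<bar>?v j \<bullet> bh\<bar> \<le> 1" if "j < 2 ^ p" for j
    proof -
      \<comment> \<open>A mean of signs lies in [-1, 1], which is the parameter constraint for
        \<open>bh\<close>.\<close>
      have "\<bar>cell_sum p n r a j\<bar> \<le> cell_count p n a j"
        unfolding cell_sum_def cell_count_def
        by (rule sum_abs[THEN order_trans], rule sum_mono) (use r in auto)
      then show ?thesis using bh(2) pos that by simp
    qed
    moreover have "0 \<le> qh u" for u unfolding qh_def by simp
    ultimately show ?thesis
      unfolding model_params_def using bh(1) by (simp add: linf_norm_sylvester_le_iff)
  qed
  have likelihood_hat: "likelihood n r a (qh, bh) = (\<Prod>i<n. E (y i))"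
    unfolding likelihood by (intro prod.cong) (use E_eq y in auto)
  note Gibbs = empirical_likelihood_le[where y = y and n = n, OF \<open>finite \<Omega>\<close> y P_model, folded E_def]
  have max: "likelihood n r a \<theta> \<le> likelihood n r a (qh, bh)" if "\<theta> \<in> model_params p" for \<theta>
    unfolding likelihood_hat unfolding likelihood by (rule Gibbs(1)) (use that in auto)
  show ?thesis unfolding bh_def[symmetric]
  proof
    assume "b = bh"
    then show "is_mle p n r a b"
      unfolding is_mle_def using model max by auto
  next
    assume "is_mle p n r a b"
    then obtain q where qb: "(q, b) \<in> model_params p"
      "\<forall>\<theta>\<in>model_params p. likelihood n r a \<theta> \<le> likelihood n r a (q, b)"
      unfolding is_mle_def by auto
    have b: "b \<in> carrier_vec (2 ^ p)" using qb(1) unfolding model_params_def by simp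
    have "likelihood n r a (q, b) = likelihood n r a (qh, bh)"
      using qb(2) model max[OF qb(1)] by (simp add: antisym)
    then have "(\<Prod>i<n. P (q, b) (y i)) = (\<Prod>i<n. E (y i))"
      unfolding likelihood_hat unfolding likelihood .
    then have eq: "P (q, b) z = P (qh, bh) z" if "z \<in> \<Omega>" for z
      using Gibbs(2)[of "(q, b)" z] qb(1) \<open>n > 0\<close> that E_eq by simp
    show "b = bh"
    proof (rule sylvester_vec_eqI[OF b bh(1)])
      fix j :: nat assume j: "j < 2 ^ p"
      then have "(-1, ?v j) \<in> \<Omega>" "(1, ?v j) \<in> \<Omega>"
        unfolding \<Omega>_def set_rows_sylvester by auto
      \<comment> \<open>Adding the two equations eliminates the vectors and identifies the cell
        masses; since these are nonzero, either equation then identifies the products with row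
        \<open>j\<close>.\<close>
      from this[THEN eq] have 1: "q (?v j) * (1 - b \<bullet> ?v j) = qh (?v j) * (1 - bh \<bullet> ?v j)"
        "q (?v j) * (1 + b \<bullet> ?v j) = qh (?v j) * (1 + bh \<bullet> ?v j)"
        by (simp_all add: P_def)
      then have "q (?v j) = qh (?v j)" by (simp add: algebra_simps)
      moreover have "qh (?v j) \<noteq> 0" using qh[of j] pos[OF j] \<open>n > 0\<close> by simp
      ultimately have "b \<bullet> ?v j = bh \<bullet> ?v j" using 1(2) by simp
      then show "?v j \<bullet> b = ?v j \<bullet> bh"
        using comm_scalar_prod[OF b row_sylvester_carrier] comm_scalar_prod[OF bh(1) row_sylvester_carrier]
        by simp
    qed
  qed
qed

subsection \<open>Consistency and asymptotic normality\<close>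

locale iid_binary_sample = prob_space M
  for M :: "'a measure" and p :: nat and B :: "'a \<Rightarrow> real" and A :: "'a \<Rightarrow> real vec"
    and Bs :: "nat \<Rightarrow> 'a \<Rightarrow> real" and As :: "nat \<Rightarrow> 'a \<Rightarrow> real vec" and \<beta> :: "real vec" +
  assumes BA_measurable: "(\<lambda>\<omega>. (B \<omega>, A \<omega>)) \<in> measurable M (count_space ({-1, 1} \<times> sign_vecs p))"
    and indep: "indep_vars (\<lambda>_. count_space ({-1, 1} \<times> sign_vecs p)) (\<lambda>i \<omega>. (Bs i \<omega>, As i \<omega>)) UNIV"
    and identically_distributed:
      "distr M (count_space ({-1, 1} \<times> sign_vecs p)) (\<lambda>\<omega>. (Bs i \<omega>, As i \<omega>)) =
       distr M (count_space ({-1, 1} \<times> sign_vecs p)) (\<lambda>\<omega>. (B \<omega>, A \<omega>))"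
    and cond_exp_less_1: "AE \<omega> in M. \<bar>cond_exp_given p M B A \<omega>\<bar> < 1"
    and \<beta>_carrier: "\<beta> \<in> carrier_vec (2 ^ p)"
    and cond_exp: "AE \<omega> in M. cond_exp_given p M B A \<omega> = \<beta> \<bullet> tensor_vec (A \<omega>)"
    and \<beta>_unique: "b \<in> carrier_vec (2 ^ p) \<Longrightarrow>
       AE \<omega> in M. cond_exp_given p M B A \<omega> = b \<bullet> tensor_vec (A \<omega>) \<Longrightarrow> b = \<beta>"
begin

abbreviation v :: "nat \<Rightarrow> real vec" where "v j \<equiv> row (sylvester p) j"

definition cell_prob :: "nat \<Rightarrow> real" where
  "cell_prob j = prob {\<omega> \<in> space M. tensor_vec (A \<omega>) = v j}"

definition cell_mean :: "nat \<Rightarrow> real" where "cell_mean j = v j \<bullet> \<beta>"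

lemma BA_in: "\<omega> \<in> space M \<Longrightarrow> B \<omega> = -1 \<or> B \<omega> = 1" "\<omega> \<in> space M \<Longrightarrow> A \<omega> \<in> sign_vecs p"
  using measurable_space[OF BA_measurable] by auto

lemma BAs_measurable: "(\<lambda>\<omega>. (Bs i \<omega>, As i \<omega>)) \<in> measurable M (count_space ({-1, 1} \<times> sign_vecs p))"
  using indep unfolding indep_vars_def by auto

lemma BAs_in: "\<omega> \<in> space M \<Longrightarrow> Bs i \<omega> = -1 \<or> Bs i \<omega> = 1" "\<omega> \<in> space M \<Longrightarrow> As i \<omega> \<in> sign_vecs p"
  using measurable_space[OF BAs_measurable] by auto

lemma A_measurable [measurable]: "A \<in> measurable M (count_space (sign_vecs p))"
  using measurable_compose[OF BA_measurable, of snd "count_space (sign_vecs p)"] by (simp add: Pi_iff)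

lemma B_measurable [measurable]: "B \<in> borel_measurable M"
  using measurable_compose[OF BA_measurable, of fst borel] by simp

text \<open>The sample takes values in a \<open>count_space\<close>, so an arbitrary
  \<open>g\<close> is measurable on it; the same reason serves for the copies and for their
  independence.\<close>

lemma g_BA_measurable: "(\<lambda>\<omega>. g (B \<omega>) (A \<omega>)) \<in> borel_measurable M" for g :: "real \<Rightarrow> real vec \<Rightarrow> real"
  using measurable_compose[OF BA_measurable, of "\<lambda>z. g (fst z) (snd z)" borel] by simp

lemma g_BAs_measurable: "(\<lambda>\<omega>. g (Bs i \<omega>) (As i \<omega>)) \<in> borel_measurable M" for g :: "real \<Rightarrow> real vec \<Rightarrow> real"
  using measurable_compose[OF BAs_measurable, of "\<lambda>z. g (fst z) (snd z)" borel] by simp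

lemma g_BAs_indep: "indep_vars (\<lambda>_. borel) (\<lambda>i \<omega>. g (Bs i \<omega>) (As i \<omega>)) UNIV"
  for g :: "real \<Rightarrow> real vec \<Rightarrow> real"
  using indep_vars_compose2[OF indep, of "\<lambda>_ z. g (fst z) (snd z)" "\<lambda>_. borel"] by simp

lemma g_BAs_distr: "distr M borel (\<lambda>\<omega>. g (Bs i \<omega>) (As i \<omega>)) = distr M borel (\<lambda>\<omega>. g (B \<omega>) (A \<omega>))"
  for g :: "real \<Rightarrow> real vec \<Rightarrow> real"
proof -
  let ?N = "count_space ({-1, 1} \<times> sign_vecs p)" and ?g = "\<lambda>z. g (fst z) (snd z)"
  have "distr M borel (\<lambda>\<omega>. g (Bs i \<omega>) (As i \<omega>)) = distr (distr M ?N (\<lambda>\<omega>. (Bs i \<omega>, As i \<omega>))) borel ?g"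
    by (subst distr_distr[OF _ BAs_measurable]) (auto simp: comp_def)
  also have "\<dots> = distr M borel (\<lambda>\<omega>. g (B \<omega>) (A \<omega>))"
    unfolding identically_distributed by (subst distr_distr[OF _ BA_measurable]) (auto simp: comp_def)
  finally show ?thesis .
qed

lemma g_BAs_expectation: "expectation (\<lambda>\<omega>. g (Bs i \<omega>) (As i \<omega>)) = expectation (\<lambda>\<omega>. g (B \<omega>) (A \<omega>))"
  for g :: "real \<Rightarrow> real vec \<Rightarrow> real"
proof -
  have "expectation (\<lambda>\<omega>. g (Bs i \<omega>) (As i \<omega>)) = (\<integral>x. x \<partial>distr M borel (\<lambda>\<omega>. g (Bs i \<omega>) (As i \<omega>)))"
    by (rule integral_distr[symmetric, OF g_BAs_measurable]) simp
  also have "\<dots> = expectation (\<lambda>\<omega>. g (B \<omega>) (A \<omega>))"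
    unfolding g_BAs_distr by (rule integral_distr[OF g_BA_measurable]) simp
  finally show ?thesis .
qed

section \<open>Conditional expectation on the cells\<close>

definition \<F> :: "'a measure" where "\<F> = vimage_algebra (space M) A (count_space (sign_vecs p))"

lemma \<F>_sets: "{\<omega> \<in> space M. Q (A \<omega>)} \<in> sets \<F>"
proof -
  have "{\<omega> \<in> space M. Q (A \<omega>)} = A -` {a \<in> sign_vecs p. Q a} \<inter> space M"
    using BA_in(2) by auto
  then show ?thesis
    unfolding \<F>_def by (simp only:) (rule in_vimage_algebra, simp)
qed

lemma \<F>_subalgebra: "subalgebra M \<F>"
proof -
  have "sets \<F> \<subseteq> sets M"
    unfolding \<F>_def by (subst sets_vimage_algebra2) (use BA_in(2) measurable_sets[OF A_measurable] in auto)
  then show ?thesis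
    unfolding subalgebra_def by (simp add: \<F>_def)
qed

lemma cell_in_events [measurable]: "{\<omega> \<in> space M. Q (A \<omega>)} \<in> events"
  using \<F>_sets[of Q] \<F>_subalgebra unfolding subalgebra_def by auto

text \<open>If the cell of \<open>v j\<close> were null, \<open>\<beta> + v j\<close> would represent the conditional expectation as well,
  because \<open>v j\<close> is orthogonal to all other rows.\<close>

lemma cell_prob_pos:
  assumes j: "j < 2 ^ p"
  shows "cell_prob j > 0"
proof (rule ccontr)
  assume "\<not> cell_prob j > 0"
  then have "prob {\<omega> \<in> space M. tensor_vec (A \<omega>) = v j} = 0"
    unfolding cell_prob_def using measure_nonneg[of M] by (simp add: antisym not_less)
  then have "AE \<omega> in M. tensor_vec (A \<omega>) \<noteq> v j"
    by (subst (asm) prob_Collect_eq_0) (use cell_in_events in auto)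
  with cond_exp have "AE \<omega> in M. cond_exp_given p M B A \<omega> = (\<beta> + v j) \<bullet> tensor_vec (A \<omega>)"
  proof (rule AE_mp[OF AE_conjI], intro AE_I2 impI)
    fix \<omega> assume \<omega>: "\<omega> \<in> space M"
      and *: "cond_exp_given p M B A \<omega> = \<beta> \<bullet> tensor_vec (A \<omega>) \<and> tensor_vec (A \<omega>) \<noteq> v j"
    have "tensor_vec (A \<omega>) \<in> carrier_vec (2 ^ p)"
      by (rule tensor_vec_carrier[OF BA_in(2)[OF \<omega>]])
    then have "(\<beta> + v j) \<bullet> tensor_vec (A \<omega>) = \<beta> \<bullet> tensor_vec (A \<omega>) + v j \<bullet> tensor_vec (A \<omega>)"
      by (rule add_scalar_prod_distrib[OF \<beta>_carrier row_sylvester_carrier])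
    then show "cond_exp_given p M B A \<omega> = (\<beta> + v j) \<bullet> tensor_vec (A \<omega>)"
      using * row_scalar_tensor[OF BA_in(2)[OF \<omega>] j] by simp
  qed
  then have "\<beta> + v j = \<beta>"
    by (intro \<beta>_unique add_carrier_vec \<beta>_carrier row_sylvester_carrier)
  then have "v j \<bullet> (\<beta> + v j) = v j \<bullet> \<beta>" by simp
  then have "v j \<bullet> v j = 0"
    by (simp add: scalar_prod_add_distrib[OF row_sylvester_carrier \<beta>_carrier row_sylvester_carrier])
  then show False using scalar_prod_row_sylvester[OF j j] by simp
qed

text \<open>A cell is an event generated by \<open>A\<close>, so \<open>B\<close> may be replaced
  there by its conditional expectation, which is the constant \<open>cell_mean j\<close> on
  it.\<close>

lemma cell_expectation:
  "expectation (\<lambda>\<omega>. of_bool (tensor_vec (A \<omega>) = v j)) = cell_prob j"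
  "expectation (\<lambda>\<omega>. of_bool (tensor_vec (A \<omega>) = v j) * B \<omega>) = cell_prob j * cell_mean j"
proof -
  interpret finite_measure_subalgebra M \<F>
    by unfold_locales (rule \<F>_subalgebra)
  let ?S = "{\<omega> \<in> space M. tensor_vec (A \<omega>) = v j}"
  have S [measurable]: "?S \<in> events" by (rule cell_in_events)
  have "expectation (\<lambda>\<omega>. of_bool (tensor_vec (A \<omega>) = v j)) = expectation (indicat_real ?S)"
    by (rule Bochner_Integration.integral_cong) (auto simp: indicator_def)
  then show prob_eq: "expectation (\<lambda>\<omega>. of_bool (tensor_vec (A \<omega>) = v j)) = cell_prob j"
    unfolding cell_prob_def using S by simp
  have "integrable M B"
    by (rule integrable_const_bound[where B = 1]) (use BA_in(1) in force)+
  have "expectation (\<lambda>\<omega>. of_bool (tensor_vec (A \<omega>) = v j) * B \<omega>) = (\<integral>\<omega>\<in>?S. B \<omega> \<partial>M)"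
    unfolding set_lebesgue_integral_def
    by (rule Bochner_Integration.integral_cong) (auto simp: indicator_def)
  also have "\<dots> = (\<integral>\<omega>\<in>?S. real_cond_exp M \<F> B \<omega> \<partial>M)"
    using \<open>integrable M B\<close> \<F>_sets by (rule real_cond_exp_intA)
  also have "\<dots> = (\<integral>\<omega>. of_bool (tensor_vec (A \<omega>) = v j) * cell_mean j \<partial>M)"
    unfolding set_lebesgue_integral_def
  proof (rule integral_cong_AE)
    show "AE \<omega> in M. indicat_real ?S \<omega> *\<^sub>R real_cond_exp M \<F> B \<omega> =
        of_bool (tensor_vec (A \<omega>) = v j) * cell_mean j"
      using cond_exp
    proof (rule AE_mp, intro AE_I2 impI)
      fix \<omega> assume "\<omega> \<in> space M" "cond_exp_given p M B A \<omega> = \<beta> \<bullet> tensor_vec (A \<omega>)"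
      then show "indicat_real ?S \<omega> *\<^sub>R real_cond_exp M \<F> B \<omega> = of_bool (tensor_vec (A \<omega>) = v j) * cell_mean j"
        using comm_scalar_prod[OF \<beta>_carrier row_sylvester_carrier]
        by (auto simp: indicator_def cond_exp_given_def cell_mean_def \<F>_def)
    qed
    show "(\<lambda>\<omega>. of_bool (tensor_vec (A \<omega>) = v j) * cell_mean j) \<in> borel_measurable M"
      by (rule g_BA_measurable)
  qed measurable
  also have "\<dots> = cell_prob j * cell_mean j"
    by (simp add: prob_eq)
  finally show "expectation (\<lambda>\<omega>. of_bool (tensor_vec (A \<omega>) = v j) * B \<omega>) = cell_prob j * cell_mean j" .
qed

text \<open>The conditional expectation is constant on a cell of positive probability, so an almost
  sure bound must hold for that constant.\<close>

lemma abs_cell_mean_less_1: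
  assumes j: "j < 2 ^ p"
  shows "\<bar>cell_mean j\<bar> < 1"
proof (rule ccontr)
  assume ge: "\<not> \<bar>cell_mean j\<bar> < 1"
  have "AE \<omega> in M. tensor_vec (A \<omega>) \<noteq> v j"
    using cond_exp cond_exp_less_1
  proof (rule AE_mp[OF AE_conjI], intro AE_I2 impI notI)
    fix \<omega> assume "cond_exp_given p M B A \<omega> = \<beta> \<bullet> tensor_vec (A \<omega>) \<and> \<bar>cond_exp_given p M B A \<omega>\<bar> < 1"
      "tensor_vec (A \<omega>) = v j"
    then show False
      using ge comm_scalar_prod[OF \<beta>_carrier row_sylvester_carrier, of j] by (auto simp: cell_mean_def)
  qed
  then have "prob {\<omega> \<in> space M. tensor_vec (A \<omega>) = v j} = 0"
    by (subst prob_Collect_eq_0) (use cell_in_events in auto)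
  then show False
    using cell_prob_pos[OF j] by (simp add: cell_prob_def)
qed

text \<open>The sum is centred at the true cell mean, not at the empirical one. Divided by the cell
  count it is \<open>v j \<bullet> (\<beta>hat n \<omega> - \<beta>)\<close> whenever the Gram
  matrix is invertible.\<close>

definition residual_sum :: "nat \<Rightarrow> nat \<Rightarrow> 'a \<Rightarrow> real" where
  "residual_sum j n \<omega> = (\<Sum>i<n. of_bool (tensor_vec (As i \<omega>) = v j) * (Bs i \<omega> - cell_mean j))"

lemma residual_sum_eq:
  "residual_sum j n \<omega> = cell_sum p n (\<lambda>i. Bs i \<omega>) (\<lambda>i. As i \<omega>) j - cell_mean j * cell_count p n (\<lambda>i. As i \<omega>) j"
  unfolding residual_sum_def cell_sum_def cell_count_def
  by (simp only: right_diff_distrib sum_subtractf sum_distrib_left) (simp only: mult.commute)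

lemma bounded_integrable:
  fixes g :: "real \<Rightarrow> real vec \<Rightarrow> real"
  assumes "\<And>\<omega>. \<omega> \<in> space M \<Longrightarrow> \<bar>g (B \<omega>) (A \<omega>)\<bar> \<le> C"
  shows "integrable M (\<lambda>\<omega>. g (B \<omega>) (A \<omega>))"
  by (rule integrable_const_bound[where B = C]) (use assms in \<open>auto intro: g_BA_measurable\<close>)

lemma of_bool_integrable:
  "integrable M (\<lambda>\<omega>. of_bool (tensor_vec (A \<omega>) = v j) :: real)"
  "integrable M (\<lambda>\<omega>. of_bool (tensor_vec (A \<omega>) = v j) * B \<omega>)"
proof -
  have "\<bar>of_bool (tensor_vec (A \<omega>) = v j) * B \<omega>\<bar> \<le> 1" if "\<omega> \<in> space M" for \<omega>
    using BA_in(1)[OF that] by auto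
  then show "integrable M (\<lambda>\<omega>. of_bool (tensor_vec (A \<omega>) = v j) * B \<omega>)"
    by (rule bounded_integrable)
  show "integrable M (\<lambda>\<omega>. of_bool (tensor_vec (A \<omega>) = v j) :: real)"
    by (rule bounded_integrable[where C = 1]) simp
qed

text \<open>Since \<open>B\<close> squares to 1, the squared residual is affine in \<open>B\<close>
  and the two cell expectations suffice.\<close>

lemma residual_moments:
  "expectation (\<lambda>\<omega>. of_bool (tensor_vec (A \<omega>) = v j) * (B \<omega> - cell_mean j)) = 0"
  "expectation (\<lambda>\<omega>. of_bool (tensor_vec (A \<omega>) = v j) * (B \<omega> - cell_mean j)\<^sup>2) = cell_prob j * (1 - (cell_mean j)\<^sup>2)"
proof -
  note int = of_bool_integrable[of j]
  show "expectation (\<lambda>\<omega>. of_bool (tensor_vec (A \<omega>) = v j) * (B \<omega> - cell_mean j)) = 0"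
    using int by (simp add: right_diff_distrib cell_expectation)
  have "expectation (\<lambda>\<omega>. of_bool (tensor_vec (A \<omega>) = v j) * (B \<omega> - cell_mean j)\<^sup>2) =
      expectation (\<lambda>\<omega>. (1 + (cell_mean j)\<^sup>2) * of_bool (tensor_vec (A \<omega>) = v j) -
        2 * cell_mean j * (of_bool (tensor_vec (A \<omega>) = v j) * B \<omega>))"
  proof (rule Bochner_Integration.integral_cong)
    fix \<omega> assume "\<omega> \<in> space M"
    then have "(B \<omega>)\<^sup>2 = 1" using BA_in(1)[of \<omega>] by auto
    then show "of_bool (tensor_vec (A \<omega>) = v j) * (B \<omega> - cell_mean j)\<^sup>2 =
        (1 + (cell_mean j)\<^sup>2) * of_bool (tensor_vec (A \<omega>) = v j) -
        2 * cell_mean j * (of_bool (tensor_vec (A \<omega>) = v j) * B \<omega>)"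
      by (simp add: power2_diff)
  qed simp
  also have "\<dots> = (1 + (cell_mean j)\<^sup>2) * cell_prob j - 2 * cell_mean j * (cell_prob j * cell_mean j)"
    using int by (simp add: cell_expectation)
  finally show "expectation (\<lambda>\<omega>. of_bool (tensor_vec (A \<omega>) = v j) * (B \<omega> - cell_mean j)\<^sup>2) = cell_prob j * (1 - (cell_mean j)\<^sup>2)"
    by (simp add: algebra_simps power2_eq_square)
qed

lemma AE_deviations:
  "AE \<omega> in M. \<forall>j<2 ^ p.
     (\<lambda>n. (cell_count p n (\<lambda>i. As i \<omega>) j - real n * cell_prob j) / real n powr (3/4)) \<longlonglongrightarrow> 0 \<and>
     (\<lambda>n. residual_sum j n \<omega> / real n powr (3/4)) \<longlonglongrightarrow> 0"
proof -
  have "AE \<omega> in M.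
     (\<lambda>n. (cell_count p n (\<lambda>i. As i \<omega>) j - real n * cell_prob j) / real n powr (3/4)) \<longlonglongrightarrow> 0 \<and>
     (\<lambda>n. residual_sum j n \<omega> / real n powr (3/4)) \<longlonglongrightarrow> 0" if j: "j < 2 ^ p" for j
  proof (rule AE_conjI)
    let ?g = "\<lambda>r a. of_bool (tensor_vec a = v j) :: real" and ?h = "\<lambda>r a. of_bool (tensor_vec a = v j) * (r - cell_mean j)"
    show "AE \<omega> in M. (\<lambda>n. (cell_count p n (\<lambda>i. As i \<omega>) j - real n * cell_prob j) / real n powr (3/4)) \<longlonglongrightarrow> 0"
      unfolding cell_count_def
      by (rule AE_deviation_powr[where C = 1, OF g_BAs_indep[of ?g]])
        (simp_all add: g_BAs_expectation[of ?g] cell_expectation)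
    have "\<bar>?h (Bs i \<omega>) (As i \<omega>)\<bar> \<le> 2" if "\<omega> \<in> space M" for i \<omega>
      using BAs_in(1)[OF that, of i] abs_cell_mean_less_1[OF j] by (auto simp: abs_mult)
    then have "AE \<omega> in M. (\<lambda>n. (residual_sum j n \<omega> - real n * 0) / real n powr (3/4)) \<longlonglongrightarrow> 0"
      unfolding residual_sum_def
      by (rule AE_deviation_powr[where C = 2, OF g_BAs_indep[of ?h]])
        (simp_all add: g_BAs_expectation[of ?h] residual_moments)
    then show "AE \<omega> in M. (\<lambda>n. residual_sum j n \<omega> / real n powr (3/4)) \<longlonglongrightarrow> 0"
      by simp
  qed
  then have "AE \<omega> in M. \<forall>j\<in>{..<2 ^ p}.
     (\<lambda>n. (cell_count p n (\<lambda>i. As i \<omega>) j - real n * cell_prob j) / real n powr (3/4)) \<longlonglongrightarrow> 0 \<and>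
     (\<lambda>n. residual_sum j n \<omega> / real n powr (3/4)) \<longlonglongrightarrow> 0"
    by (intro AE_finite_allI) auto
  then show ?thesis by (simp only: Ball_def lessThan_iff)
qed

text \<open>A diagonal entry of \<open>D_matrix\<close>; it is the limiting variance of the
  \<open>j\<close>-th row product of the scaled estimation error.\<close>

definition cell_variance :: "nat \<Rightarrow> real" where
  "cell_variance j = (1 - (cell_mean j)\<^sup>2) / cell_prob j"

lemma cell_variance_nonneg: "j < 2 ^ p \<Longrightarrow> 0 \<le> cell_variance j"
  using cell_prob_pos[of j] abs_cell_mean_less_1[of j] abs_square_less_1[of "cell_mean j"]
  unfolding cell_variance_def by simp

lemma D_matrix_eq: "D_matrix p M A \<beta> = mat_diag (2 ^ p) cell_variance"
  unfolding D_matrix_def cell_variance_def cell_mean_def cell_prob_def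
  by (simp add: comm_scalar_prod[OF \<beta>_carrier row_sylvester_carrier])

text \<open>Exchanging the sums over cells and observations gives a normalized sum of i.i.d.
  variables \<open>g (Bs i) (As i)\<close>. Cells are disjoint, so squaring \<open>g\<close>
  produces no cross terms and the variances of the cells simply add.\<close>

lemma weak_conv_residuals:
  "weak_conv_m (\<lambda>n. distr M borel (\<lambda>\<omega>. \<Sum>j<2 ^ p. u j * (residual_sum j n \<omega> / sqrt (real n) / cell_prob j)))
     (normal_law 0 (\<Sum>j<2 ^ p. (u j)\<^sup>2 * cell_variance j))"
proof -
  define g where "g r a = (\<Sum>j<2 ^ p. u j / cell_prob j * (of_bool (tensor_vec a = v j) * (r - cell_mean j)))" for r a
  have sum_eq: "(\<Sum>j<2 ^ p. u j * (residual_sum j n \<omega> / sqrt (real n) / cell_prob j)) =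
      (\<Sum>i<n. g (Bs i \<omega>) (As i \<omega>)) / sqrt (real n)" for n \<omega>
  proof -
    have "(\<Sum>i<n. g (Bs i \<omega>) (As i \<omega>)) = (\<Sum>j<2 ^ p. u j / cell_prob j * residual_sum j n \<omega>)"
      unfolding g_def residual_sum_def sum_distrib_left by (rule sum.swap)
    then show ?thesis
      by (simp add: sum_divide_distrib mult_ac)
  qed
  have int: "integrable M (\<lambda>\<omega>. of_bool (tensor_vec (A \<omega>) = v j) * (B \<omega> - cell_mean j))"
    "integrable M (\<lambda>\<omega>. of_bool (tensor_vec (A \<omega>) = v j) * (B \<omega> - cell_mean j)\<^sup>2)" if j: "j < 2 ^ p" for j
  proof -
    have le: "\<bar>B \<omega> - cell_mean j\<bar> \<le> 2" if "\<omega> \<in> space M" for \<omega>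
      using BA_in(1)[OF that] abs_cell_mean_less_1[OF j] by auto
    then have le2: "(B \<omega> - cell_mean j)\<^sup>2 \<le> 4" if "\<omega> \<in> space M" for \<omega>
      using that power_mono[of "\<bar>B \<omega> - cell_mean j\<bar>" 2 2] by simp
    show "integrable M (\<lambda>\<omega>. of_bool (tensor_vec (A \<omega>) = v j) * (B \<omega> - cell_mean j))"
      by (rule bounded_integrable[where C = 2]) (use le in \<open>auto simp: abs_mult\<close>)
    show "integrable M (\<lambda>\<omega>. of_bool (tensor_vec (A \<omega>) = v j) * (B \<omega> - cell_mean j)\<^sup>2)"
      by (rule bounded_integrable[where C = 4]) (use le2 in \<open>auto simp: abs_mult\<close>)
  qed
  have mean: "expectation (\<lambda>\<omega>. g (B \<omega>) (A \<omega>)) = 0"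
    unfolding g_def using int(1) by (subst Bochner_Integration.integral_sum) (auto simp: residual_moments)
  have square: "(g (B \<omega>) (A \<omega>))\<^sup>2 =
      (\<Sum>j<2 ^ p. (u j / cell_prob j)\<^sup>2 * (of_bool (tensor_vec (A \<omega>) = v j) * (B \<omega> - cell_mean j)\<^sup>2))"
    if \<omega>: "\<omega> \<in> space M" for \<omega>
  proof -
    obtain k where k: "k < 2 ^ p" "tensor_vec (A \<omega>) = v k"
      using tensor_vecE[OF BA_in(2)[OF \<omega>]] by metis
    \<comment> \<open>Exactly one indicator is 1, since distinct indices have distinct rows. The
      fact is used twice, for \<open>g\<close> itself and for the sum of squares.\<close>
    have collapse: "(\<Sum>j<2 ^ p. a j * (of_bool (tensor_vec (A \<omega>) = v j) * b j)) = a k * b k" for a b :: "nat \<Rightarrow> real"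
    proof -
      have "(\<Sum>j<2 ^ p. a j * (of_bool (tensor_vec (A \<omega>) = v j) * b j)) = (\<Sum>j<2 ^ p. if j = k then a k * b k else 0)"
        by (intro sum.cong) (use k in \<open>auto simp: row_sylvester_eq_iff\<close>)
      then show ?thesis using k(1) by simp
    qed
    show ?thesis
      unfolding g_def collapse by (simp add: power_mult_distrib power_divide)
  qed
  have square_int: "integrable M (\<lambda>\<omega>. (g (B \<omega>) (A \<omega>))\<^sup>2)"
    by (rule iffD2[OF Bochner_Integration.integrable_cong[OF refl square]], assumption)
      (use int(2) in auto)
  have "expectation (\<lambda>\<omega>. (g (B \<omega>) (A \<omega>))\<^sup>2) = expectation (\<lambda>\<omega>.
      \<Sum>j<2 ^ p. (u j / cell_prob j)\<^sup>2 * (of_bool (tensor_vec (A \<omega>) = v j) * (B \<omega> - cell_mean j)\<^sup>2))"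
    by (rule Bochner_Integration.integral_cong[OF refl square])
  also have "\<dots> = (\<Sum>j<2 ^ p. (u j / cell_prob j)\<^sup>2 * (cell_prob j * (1 - (cell_mean j)\<^sup>2)))"
    using int(2) by (subst Bochner_Integration.integral_sum) (auto simp: residual_moments)
  also have "\<dots> = (\<Sum>j<2 ^ p. (u j)\<^sup>2 * cell_variance j)"
    by (intro sum.cong) (use cell_prob_pos in \<open>auto simp: cell_variance_def power_divide power2_eq_square\<close>)
  finally have var: "expectation (\<lambda>\<omega>. (g (B \<omega>) (A \<omega>))\<^sup>2) = (\<Sum>j<2 ^ p. (u j)\<^sup>2 * cell_variance j)" .
  have "integrable (distr M borel (\<lambda>\<omega>. g (Bs i \<omega>) (As i \<omega>))) (\<lambda>x. x\<^sup>2)" for i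
    unfolding g_BAs_distr using square_int by (subst integrable_distr_eq) (auto intro: g_BA_measurable)
  then have square_int': "integrable M (\<lambda>\<omega>. (g (Bs i \<omega>) (As i \<omega>))\<^sup>2)" for i
    by (subst (asm) integrable_distr_eq) (auto intro: g_BAs_measurable)
  show ?thesis
    unfolding sum_eq
    by (rule central_limit_theorem_normal_law[OF g_BAs_indep _ square_int' _ g_BAs_distr])
      (simp_all add: g_BAs_expectation[of g] g_BAs_expectation[of "\<lambda>r a. (g r a)\<^sup>2"] mean var)
qed

end

section \<open>Limits of the estimator\<close>

locale least_squares_estimator = iid_binary_sample M p B A Bs As \<beta>
  for M :: "'a measure" and p :: nat and B A Bs As \<beta> +
  fixes \<beta>hat :: "nat \<Rightarrow> 'a \<Rightarrow> real vec"
  assumes \<beta>hat_carrier: "\<omega> \<in> space M \<Longrightarrow> \<beta>hat n \<omega> \<in> carrier_vec (2 ^ p)"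
    and \<beta>hat_measurable: "i < 2 ^ p \<Longrightarrow> (\<lambda>\<omega>. \<beta>hat n \<omega> $ i) \<in> borel_measurable M"
    and \<beta>hat_eq: "\<omega> \<in> space M \<Longrightarrow> invertible_mat (gram_matrix p n (\<lambda>i. As i \<omega>)) \<Longrightarrow>
      \<beta>hat n \<omega> = least_squares p n (\<lambda>i. Bs i \<omega>) (\<lambda>i. As i \<omega>)"
begin

lemma diff_carrier: "\<omega> \<in> space M \<Longrightarrow> \<beta>hat n \<omega> - \<beta> \<in> carrier_vec (2 ^ p)"
  using \<beta>hat_carrier \<beta>_carrier by simp

text \<open>On the almost sure event of \<open>AE_deviations\<close> all cell counts are eventually
  positive, so eventually the estimator is the least squares vector and its row products are
  explicit ratios, to which \<open>ratio_asymptotics\<close> applies.\<close>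

lemma AE_row_limits:
  "AE \<omega> in M. \<forall>j<2 ^ p. (\<lambda>n. v j \<bullet> (\<beta>hat n \<omega> - \<beta>)) \<longlonglongrightarrow> 0 \<and>
     (\<lambda>n. sqrt (real n) * (v j \<bullet> (\<beta>hat n \<omega> - \<beta>)) - residual_sum j n \<omega> / sqrt (real n) / cell_prob j) \<longlonglongrightarrow> 0"
  using AE_deviations
proof (rule AE_mp, intro AE_I2 impI)
  fix \<omega> assume \<omega>: "\<omega> \<in> space M"
  let ?a = "\<lambda>i. As i \<omega>" and ?r = "\<lambda>i. Bs i \<omega>"
  assume "\<forall>j<2 ^ p.
     (\<lambda>n. (cell_count p n ?a j - real n * cell_prob j) / real n powr (3/4)) \<longlonglongrightarrow> 0 \<and>
     (\<lambda>n. residual_sum j n \<omega> / real n powr (3/4)) \<longlonglongrightarrow> 0"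
  then have asymp: "eventually (\<lambda>n. cell_count p n ?a j > 0) sequentially"
    "(\<lambda>n. residual_sum j n \<omega> / cell_count p n ?a j) \<longlonglongrightarrow> 0"
    "(\<lambda>n. sqrt (real n) * (residual_sum j n \<omega> / cell_count p n ?a j) - residual_sum j n \<omega> / sqrt (real n) / cell_prob j) \<longlonglongrightarrow> 0"
    if "j < 2 ^ p" for j
    using that ratio_asymptotics[OF cell_prob_pos, of j "\<lambda>n. cell_count p n ?a j" "\<lambda>n. residual_sum j n \<omega>"]
    by auto
  have "eventually (\<lambda>n. \<forall>j\<in>{..<2 ^ p}. cell_count p n ?a j > 0) sequentially"
    by (rule eventually_ball_finite) (use asymp(1) in auto)
  then have eq: "eventually (\<lambda>n. residual_sum j n \<omega> / cell_count p n ?a j = v j \<bullet> (\<beta>hat n \<omega> - \<beta>)) sequentially"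
    if j: "j < 2 ^ p" for j
  proof eventually_elim
    case (elim n)
    have a: "\<forall>i<n. ?a i \<in> sign_vecs p" using BAs_in(2)[OF \<omega>] by simp
    then have inv: "invertible_mat (gram_matrix p n ?a)"
      using invertible_gram_iff elim by auto
    have "v j \<bullet> (\<beta>hat n \<omega> - \<beta>) = v j \<bullet> \<beta>hat n \<omega> - cell_mean j"
      unfolding cell_mean_def
      by (rule scalar_prod_minus_distrib[OF row_sylvester_carrier \<beta>hat_carrier[OF \<omega>] \<beta>_carrier])
    also have "v j \<bullet> \<beta>hat n \<omega> = cell_sum p n ?r ?a j / cell_count p n ?a j"
      unfolding \<beta>hat_eq[OF \<omega> inv] by (rule row_least_squares(2)[OF a inv j])
    moreover have "cell_count p n ?a j > 0" using elim j by blast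
    ultimately show ?case
      by (simp add: residual_sum_eq diff_divide_distrib)
  qed
  show "\<forall>j<2 ^ p. (\<lambda>n. v j \<bullet> (\<beta>hat n \<omega> - \<beta>)) \<longlonglongrightarrow> 0 \<and>
     (\<lambda>n. sqrt (real n) * (v j \<bullet> (\<beta>hat n \<omega> - \<beta>)) - residual_sum j n \<omega> / sqrt (real n) / cell_prob j) \<longlonglongrightarrow> 0"
  proof (intro allI impI conjI)
    fix j :: nat assume j: "j < 2 ^ p"
    show "(\<lambda>n. v j \<bullet> (\<beta>hat n \<omega> - \<beta>)) \<longlonglongrightarrow> 0"
      using asymp(2)[OF j] eq[OF j] by (rule Lim_transform_eventually)
    show "(\<lambda>n. sqrt (real n) * (v j \<bullet> (\<beta>hat n \<omega> - \<beta>)) - residual_sum j n \<omega> / sqrt (real n) / cell_prob j) \<longlonglongrightarrow> 0"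
      using asymp(3)[OF j] by (rule Lim_transform_eventually) (use eq[OF j] in eventually_elim, simp)
  qed
qed

theorem consistency: "AE \<omega> in M. \<forall>i<2 ^ p. (\<lambda>n. \<beta>hat n \<omega> $ i) \<longlonglongrightarrow> \<beta> $ i"
  using AE_row_limits
proof (rule AE_mp, intro AE_I2 impI allI)
  fix \<omega> i assume \<omega>: "\<omega> \<in> space M" and i: "i < (2 :: nat) ^ p"
  assume *: "\<forall>j<2 ^ p. (\<lambda>n. v j \<bullet> (\<beta>hat n \<omega> - \<beta>)) \<longlonglongrightarrow> 0 \<and>
     (\<lambda>n. sqrt (real n) * (v j \<bullet> (\<beta>hat n \<omega> - \<beta>)) - residual_sum j n \<omega> / sqrt (real n) / cell_prob j) \<longlonglongrightarrow> 0"
  have "(\<lambda>n. (\<Sum>j<2 ^ p. v j $ i * (v j \<bullet> (\<beta>hat n \<omega> - \<beta>))) / 2 ^ p) \<longlonglongrightarrow> (\<Sum>j<2 ^ p. v j $ i * 0) / 2 ^ p"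
    by (intro tendsto_intros) (use * in auto)
  then have "(\<lambda>n. (\<beta>hat n \<omega> - \<beta>) $ i) \<longlonglongrightarrow> 0"
    using index_eq_sylvester_sum[OF diff_carrier[OF \<omega>] i] by simp
  then have "(\<lambda>n. \<beta>hat n \<omega> $ i - \<beta> $ i) \<longlonglongrightarrow> 0"
    using i \<beta>_carrier by simp
  then show "(\<lambda>n. \<beta>hat n \<omega> $ i) \<longlonglongrightarrow> \<beta> $ i"
    by (rule LIM_zero_cancel)
qed

text \<open>Parseval writes the functional with coefficients \<open>t\<close> as a combination of
  row products with weights \<open>u j\<close>. It then splits into \<open>W\<close>, governed by
  the central limit theorem, and a remainder that vanishes almost surely.\<close>

lemma weak_conv_linear_functional:
  "weak_conv_m (\<lambda>n. distr M borel (\<lambda>\<omega>. \<Sum>k<2 ^ p. t k * (sqrt (real n) \<cdot>\<^sub>v (\<beta>hat n \<omega> - \<beta>)) $ k))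
     (normal_law 0 (\<Sum>j<2 ^ p. ((v j \<bullet> vec (2 ^ p) t) / 2 ^ p)\<^sup>2 * cell_variance j))"
proof -
  define u where "u j = (v j \<bullet> vec (2 ^ p) t) / 2 ^ p" for j
  define W where "W n \<omega> = (\<Sum>j<2 ^ p. u j * (residual_sum j n \<omega> / sqrt (real n) / cell_prob j))" for n \<omega>
  define V where "V n \<omega> = (\<Sum>k<2 ^ p. t k * (sqrt (real n) \<cdot>\<^sub>v (\<beta>hat n \<omega> - \<beta>)) $ k)" for n \<omega>
  have V_eq: "V n \<omega> = (\<Sum>j<2 ^ p. u j * (sqrt (real n) * (v j \<bullet> (\<beta>hat n \<omega> - \<beta>))))" if \<omega>: "\<omega> \<in> space M" for n \<omega>
  proof -
    let ?x = "sqrt (real n) \<cdot>\<^sub>v (\<beta>hat n \<omega> - \<beta>)"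
    have x: "?x \<in> carrier_vec (2 ^ p)" using diff_carrier[OF \<omega>] by simp
    have "V n \<omega> = vec (2 ^ p) t \<bullet> ?x"
      unfolding V_def scalar_prod_def carrier_vecD[OF x] by (auto simp: lessThan_atLeast0 intro!: sum.cong)
    also have "\<dots> = (\<Sum>j<2 ^ p. (v j \<bullet> vec (2 ^ p) t) * (v j \<bullet> ?x)) / 2 ^ p"
      using sylvester_Parseval[OF vec_carrier x] by simp
    also have "\<dots> = (\<Sum>j<2 ^ p. u j * (sqrt (real n) * (v j \<bullet> (\<beta>hat n \<omega> - \<beta>))))"
      unfolding u_def sum_divide_distrib
      by (intro sum.cong) (simp_all add: scalar_prod_smult_distrib[OF row_sylvester_carrier diff_carrier[OF \<omega>]])
    finally show ?thesis .
  qed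
  have W_measurable: "W n \<in> borel_measurable M" for n
  proof -
    have "residual_sum j n \<in> borel_measurable M" for j
      unfolding residual_sum_def
      by (intro borel_measurable_sum g_BAs_measurable[of "\<lambda>r a. of_bool (tensor_vec a = v j) * (r - cell_mean j)"])
    then show ?thesis unfolding W_def by measurable
  qed
  have V_measurable: "V n \<in> borel_measurable M" for n
  proof -
    have "(\<lambda>\<omega>. \<Sum>k<2 ^ p. t k * (sqrt (real n) * (\<beta>hat n \<omega> $ k - \<beta> $ k))) \<in> borel_measurable M"
      by (intro borel_measurable_sum borel_measurable_times borel_measurable_diff
          borel_measurable_const \<beta>hat_measurable) simp
    \<comment> \<open>The dimension of a difference of vectors is that of the subtracted one, here
      \<beta>; hence the identity holds for every outcome, even outside the sample space.\<close>
    moreover have "V n \<omega> = (\<Sum>k<2 ^ p. t k * (sqrt (real n) * (\<beta>hat n \<omega> $ k - \<beta> $ k)))" for \<omega>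
      unfolding V_def using \<beta>_carrier by (intro sum.cong) auto
    ultimately show ?thesis by presburger
  qed
  have "weak_conv_m (\<lambda>n. distr M borel (\<lambda>\<omega>. W n \<omega> + (V n \<omega> - W n \<omega>))) (normal_law 0 (\<Sum>j<2 ^ p. (u j)\<^sup>2 * cell_variance j))"
  proof (rule weak_conv_m_add_AE_null)
    show "real_distribution (normal_law 0 (\<Sum>j<2 ^ p. (u j)\<^sup>2 * cell_variance j))"
      by (intro real_distribution_normal_law sum_nonneg mult_nonneg_nonneg) (simp_all add: cell_variance_nonneg)
    show "weak_conv_m (\<lambda>n. distr M borel (W n)) (normal_law 0 (\<Sum>j<2 ^ p. (u j)\<^sup>2 * cell_variance j))"
      unfolding W_def by (rule weak_conv_residuals)
    show "AE \<omega> in M. (\<lambda>n. V n \<omega> - W n \<omega>) \<longlonglongrightarrow> 0"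
      using AE_row_limits
    proof (rule AE_mp, intro AE_I2 impI)
      fix \<omega> assume \<omega>: "\<omega> \<in> space M"
      assume *: "\<forall>j<2 ^ p. (\<lambda>n. v j \<bullet> (\<beta>hat n \<omega> - \<beta>)) \<longlonglongrightarrow> 0 \<and>
        (\<lambda>n. sqrt (real n) * (v j \<bullet> (\<beta>hat n \<omega> - \<beta>)) - residual_sum j n \<omega> / sqrt (real n) / cell_prob j) \<longlonglongrightarrow> 0"
      have "(\<lambda>n. \<Sum>j<2 ^ p. u j * (sqrt (real n) * (v j \<bullet> (\<beta>hat n \<omega> - \<beta>)) - residual_sum j n \<omega> / sqrt (real n) / cell_prob j))
          \<longlonglongrightarrow> (\<Sum>j<2 ^ p. u j * 0)"
        by (intro tendsto_intros) (use * in auto)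
      then show "(\<lambda>n. V n \<omega> - W n \<omega>) \<longlonglongrightarrow> 0"
        unfolding V_eq[OF \<omega>] W_def by (simp add: right_diff_distrib sum_subtractf)
    qed
  qed (intro borel_measurable_diff W_measurable V_measurable)+
  then show ?thesis
    by (simp add: V_def u_def)
qed

text \<open>The limit law is exhibited explicitly as the law of \<open>sylvester_gaussian\<close>
  under independent standard normal coordinates, so existence of a normal law with this covariance
  is part of the construction.\<close>

theorem asymptotic_normality:
  "\<exists>\<nu>. mv_normal_law (2 ^ p) (0\<^sub>v (2 ^ p)) (limit_cov p M A \<beta>) \<nu> \<and>
     conv_in_distr (2 ^ p) M (\<lambda>n \<omega>. sqrt (real n) \<cdot>\<^sub>v (\<beta>hat n \<omega> - \<beta>)) \<nu>"
proof -
  let ?N = "2 ^ p :: nat"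
  define L where "L = (\<Pi>\<^sub>M j\<in>{..<?N}. std_normal_distribution)"
  define Y where "Y = sylvester_gaussian p cell_variance"
  define X where "X n \<omega> = sqrt (real n) \<cdot>\<^sub>v (\<beta>hat n \<omega> - \<beta>)" for n \<omega>
  \<comment> \<open>Points of the product over \<open>{..<?N}\<close> are \<open>undefined\<close>
    outside that index set, whereas \<open>Y\<close> is 0 there; hence the restriction.\<close>
  define \<nu> where "\<nu> = distr L (Pi\<^sub>M {..<?N} (\<lambda>_. borel)) (\<lambda>x. \<lambda>k\<in>{..<?N}. Y x k)"
  interpret L: prob_space L
    unfolding L_def by (intro prob_space_PiM) (simp add: prob_space_normal_density)
  have Y_coord [measurable]: "(\<lambda>x. Y x k) \<in> borel_measurable L" for k
    unfolding Y_def L_def by (rule sylvester_gaussian_measurable)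
  have Y_measurable: "(\<lambda>x. \<lambda>k\<in>{..<?N}. Y x k) \<in> measurable L (Pi\<^sub>M {..<?N} (\<lambda>_. borel))"
    by (rule measurable_restrict) (rule Y_coord)
  have Y_distr: "distr L borel (\<lambda>x. \<Sum>k<?N. t k * Y x k) =
      normal_law 0 (\<Sum>j<?N. ((v j \<bullet> vec ?N t) / 2 ^ p)\<^sup>2 * cell_variance j)" for t
    unfolding Y_def L_def by (rule distr_sylvester_gaussian[OF cell_variance_nonneg])
  have "mv_normal_law ?N (0\<^sub>v ?N) (limit_cov p M A \<beta>) \<nu>"
    unfolding mv_normal_law_def
  proof (intro conjI ballI)
    show "prob_space \<nu>"
      unfolding \<nu>_def by (rule L.prob_space_distr[OF Y_measurable])
    show "sets \<nu> = sets (Pi\<^sub>M {..<?N} (\<lambda>_. borel))"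
      unfolding \<nu>_def by simp
    fix t :: "real vec" assume t: "t \<in> carrier_vec ?N"
    have functional: "t \<bullet> vec ?N x = (\<Sum>k<?N. t $ k * x k)" for x
      unfolding scalar_prod_def by (simp add: lessThan_atLeast0)
    have "distr \<nu> borel (\<lambda>x. t \<bullet> vec ?N x) = distr L borel (\<lambda>x. \<Sum>k<?N. t $ k * Y x k)"
      unfolding \<nu>_def functional
      by (subst distr_distr[OF _ Y_measurable]) (auto simp: comp_def intro!: borel_measurable_sum)
    also have "\<dots> = normal_law 0 (\<Sum>j<?N. ((v j \<bullet> vec ?N (($) t)) / 2 ^ p)\<^sup>2 * cell_variance j)"
      by (rule Y_distr)
    also have "vec ?N (($) t) = t"
      using t by (intro eq_vecI) auto
    finally show "distr \<nu> borel (\<lambda>x. t \<bullet> vec ?N x) = normal_law (t \<bullet> 0\<^sub>v ?N) (t \<bullet> (limit_cov p M A \<beta> *\<^sub>v t))"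
      unfolding limit_cov_def D_matrix_eq sylvester_diag_quadratic_form[OF t] using t by simp
  qed
  moreover have "conv_in_distr ?N M X \<nu>"
    unfolding conv_in_distr_def
  proof (intro conjI allI impI ballI)
    fix n \<omega> assume "\<omega> \<in> space M"
    then show "X n \<omega> \<in> carrier_vec ?N"
      unfolding X_def using diff_carrier by simp
  next
    show X_measurable: "(\<lambda>\<omega>. X n \<omega> $ i) \<in> borel_measurable M" if "i < ?N" for n i
    proof -
      have "(\<lambda>\<omega>. sqrt (real n) * (\<beta>hat n \<omega> $ i - \<beta> $ i)) \<in> borel_measurable M"
        by (intro borel_measurable_times borel_measurable_diff borel_measurable_const \<beta>hat_measurable that)
      then show ?thesis
        unfolding X_def using that \<beta>_carrier by simp
    qed
    fix f :: "real vec \<Rightarrow> real"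
    assume cont: "continuous_on UNIV (\<lambda>x :: nat \<Rightarrow> real. f (vec ?N x))"
      and bdd: "bounded (range (\<lambda>x :: nat \<Rightarrow> real. f (vec ?N x)))"
    \<comment> \<open>Indexing a vector beyond its dimension gives an unspecified value. Extension
      by 0 provides measurable coordinates for all indices, as \<open>Cramer_Wold\<close>
      demands.\<close>
    define X' where "X' n \<omega> i = (if i < ?N then X n \<omega> $ i else 0)" for n \<omega> i
    have X'_measurable: "(\<lambda>\<omega>. X' n \<omega> i) \<in> borel_measurable M" for n i
      unfolding X'_def using X_measurable by (cases "i < ?N") simp_all
    have "(\<lambda>n. \<integral>\<omega>. f (vec ?N (X' n \<omega>)) \<partial>M) \<longlonglongrightarrow> (\<integral>x. f (vec ?N (Y x)) \<partial>L)"
    proof (rule Cramer_Wold[OF prob_space_axioms L.prob_space_axioms X'_measurable Y_coord _ cont bdd])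
      fix t :: "nat \<Rightarrow> real"
      show "weak_conv_m (\<lambda>n. distr M borel (\<lambda>\<omega>. \<Sum>i<?N. t i * X' n \<omega> i)) (distr L borel (\<lambda>x. \<Sum>i<?N. t i * Y x i))"
        unfolding Y_distr using weak_conv_linear_functional[of t] by (simp add: X'_def X_def)
    next
      fix x y :: "nat \<Rightarrow> real" assume "\<And>i. i < ?N \<Longrightarrow> x i = y i"
      then have "vec ?N x = vec ?N y" by (intro eq_vecI) auto
      then show "f (vec ?N x) = f (vec ?N y)" by simp
    qed
    moreover have "(\<integral>\<omega>. f (vec ?N (X' n \<omega>)) \<partial>M) = (\<integral>\<omega>. f (X n \<omega>) \<partial>M)" for n
    proof (rule Bochner_Integration.integral_cong)
      fix \<omega> assume "\<omega> \<in> space M"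
      then have "vec ?N (X' n \<omega>) = X n \<omega>"
        unfolding X'_def X_def using \<beta>_carrier by (intro eq_vecI) auto
      then show "f (vec ?N (X' n \<omega>)) = f (X n \<omega>)" by simp
    qed simp
    moreover have "(\<integral>x. f (vec ?N (Y x)) \<partial>L) = (\<integral>x. f (vec ?N x) \<partial>\<nu>)"
    proof -
      \<comment> \<open>Continuity is known on the space of all sequences, while the limit law lives
        on the finite product. Extension by 0 is a measurable map between the two that does not
        change \<open>vec ?N x\<close>.\<close>
      define E where "E x i = (if i < ?N then x i else 0)" for x :: "nat \<Rightarrow> real" and i
      have E: "vec ?N (E x) = vec ?N x" for x
        by (intro eq_vecI) (auto simp: E_def)
      have "(\<lambda>x. E x i) \<in> borel_measurable (Pi\<^sub>M {..<?N} (\<lambda>_. borel))" for i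
        unfolding E_def by (cases "i < ?N") auto
      then have "E \<in> borel_measurable (Pi\<^sub>M {..<?N} (\<lambda>_. borel))"
        by (rule measurable_coordinatewise_then_product)
      from measurable_compose[OF this borel_measurable_continuous_onI[OF cont]]
      have "(\<lambda>x. f (vec ?N x)) \<in> borel_measurable (Pi\<^sub>M {..<?N} (\<lambda>_. borel))"
        unfolding E .
      then have "(\<integral>x. f (vec ?N x) \<partial>\<nu>) = (\<integral>x. f (vec ?N (\<lambda>k\<in>{..<?N}. Y x k)) \<partial>L)"
        unfolding \<nu>_def by (rule integral_distr[OF Y_measurable])
      also have "\<dots> = (\<integral>x. f (vec ?N (Y x)) \<partial>L)"
      proof -
        have "vec ?N (\<lambda>k\<in>{..<?N}. Y x k) = vec ?N (Y x)" for x
          by (intro eq_vecI) auto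
        then show ?thesis by simp
      qed
      finally show ?thesis ..
    qed
    ultimately show "(\<lambda>n. \<integral>\<omega>. f (X n \<omega>) \<partial>M) \<longlonglongrightarrow> (\<integral>x. f (vec ?N x) \<partial>\<nu>)"
      by simp
  qed
  ultimately show ?thesis
    unfolding X_def by blast
qed

end

theorem theorem3p2:
  fixes M :: "'a measure" and p :: nat
    and B :: "'a \<Rightarrow> real" and A :: "'a \<Rightarrow> real vec"
    and Bs :: "nat \<Rightarrow> 'a \<Rightarrow> real" and As :: "nat \<Rightarrow> 'a \<Rightarrow> real vec"
    and \<beta> :: "real vec" and \<beta>hat :: "nat \<Rightarrow> 'a \<Rightarrow> real vec"
  assumes "prob_space M"
    and "(\<lambda>\<omega>. (B \<omega>, A \<omega>)) \<in> measurable M (count_space ({-1, 1} \<times> sign_vecs p))"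
    and "prob_space.indep_vars M (\<lambda>_. count_space ({-1, 1} \<times> sign_vecs p))
           (\<lambda>i \<omega>. (Bs i \<omega>, As i \<omega>)) UNIV"
    and "\<And>i. distr M (count_space ({-1, 1} \<times> sign_vecs p)) (\<lambda>\<omega>. (Bs i \<omega>, As i \<omega>)) =
             distr M (count_space ({-1, 1} \<times> sign_vecs p)) (\<lambda>\<omega>. (B \<omega>, A \<omega>))"
    and "AE \<omega> in M. \<bar>cond_exp_given p M B A \<omega>\<bar> < 1"
    and "\<beta> \<in> carrier_vec (2 ^ p)"
    and "AE \<omega> in M. cond_exp_given p M B A \<omega> = \<beta> \<bullet> tensor_vec (A \<omega>)"
    and "\<And>b. b \<in> carrier_vec (2 ^ p) \<Longrightarrow>
           AE \<omega> in M. cond_exp_given p M B A \<omega> = b \<bullet> tensor_vec (A \<omega>) \<Longrightarrow> b = \<beta>"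
    and "\<And>n \<omega>. \<omega> \<in> space M \<Longrightarrow> \<beta>hat n \<omega> \<in> carrier_vec (2 ^ p)"
    and "\<And>n i. i < 2 ^ p \<Longrightarrow> (\<lambda>\<omega>. \<beta>hat n \<omega> $ i) \<in> borel_measurable M"
    and "\<And>n \<omega>. \<omega> \<in> space M \<Longrightarrow> invertible_mat (gram_matrix p n (\<lambda>i. As i \<omega>)) \<Longrightarrow>
           \<beta>hat n \<omega> = least_squares p n (\<lambda>i. Bs i \<omega>) (\<lambda>i. As i \<omega>)"
  shows "(\<forall>n. \<forall>\<omega>\<in>space M. invertible_mat (gram_matrix p n (\<lambda>i. As i \<omega>)) \<longrightarrow>
            (\<forall>b. is_mle p n (\<lambda>i. Bs i \<omega>) (\<lambda>i. As i \<omega>) b \<longleftrightarrow> b = \<beta>hat n \<omega>)) \<and>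
         (AE \<omega> in M. \<forall>i<2 ^ p. (\<lambda>n. \<beta>hat n \<omega> $ i) \<longlonglongrightarrow> \<beta> $ i) \<and>
         (\<exists>\<nu>. mv_normal_law (2 ^ p) (0\<^sub>v (2 ^ p)) (limit_cov p M A \<beta>) \<nu> \<and>
            conv_in_distr (2 ^ p) M (\<lambda>n \<omega>. sqrt (real n) \<cdot>\<^sub>v (\<beta>hat n \<omega> - \<beta>)) \<nu>) \<and>
         (\<forall>i<2 ^ p. limit_cov p M A \<beta> $$ (i, i) = mat_trace (D_matrix p M A \<beta>) / 2 ^ (2 * p))"
proof -
  interpret prob_space M by fact
  interpret least_squares_estimator M p B A Bs As \<beta> \<beta>hat
    by unfold_locales (fact assms)+
  have "is_mle p n (\<lambda>i. Bs i \<omega>) (\<lambda>i. As i \<omega>) b \<longleftrightarrow> b = \<beta>hat n \<omega>"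
    if "\<omega> \<in> space M" "invertible_mat (gram_matrix p n (\<lambda>i. As i \<omega>))" for n \<omega> b
    unfolding \<beta>hat_eq[OF that]
    by (rule is_mle_iff_least_squares) (use that BAs_in in auto)
  moreover have "limit_cov p M A \<beta> $$ (i, i) = mat_trace (D_matrix p M A \<beta>) / 2 ^ (2 * p)"
    if "i < 2 ^ p" for i
    unfolding limit_cov_def D_matrix_eq by (rule sylvester_diag_diagonal[OF that])
  ultimately show ?thesis
    using consistency asymptotic_normality by blast
qed

end
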